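(* \textsc{Position Matching} reduces to \textsc{2-Visits} in polynomial time.
   Context: The discretized sequence $\langle a_1,\dots,a_n\rangle$ of a non-decreasing sequence $\langle d_1,\dots,d_n\rangle$ of positive integers is given by $a_n=d_n$, $a_i=\min\{a_{i+1}-1,d_i\}$ for $i<n$. \textsc{Position Matching}: given a non-decreasing sequence $D=\langle d_1,\dots,d_n\rangle$ of positive integers, its discretized sequence $A=\langle a_1,\dots,a_n\rangle$, and a set $T$ of $n$ distinct positive integers, decide whether there is $M\subseteq D\times A\times T$ in which every element of $D$, $A$, $T$ occurs exactly once and every triple $(d,a,t)\in M$ satisfies $d\ge a$ and $d+a\ge t$. \textsc{2-Visits}: given a non-decreasing sequence of $n$ positive integers $d_1\le\dots\le d_n$, decide whether there is a schedule of length $2n$ (each position $1,\dots,2n$ holds one visit) containing exactly two visits of each node $i\in[n]$, with the first visit of $i$ at position at most $d_i$ and the second visit at most $d_i$ positions after the first. *)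

theory Defs
  imports Main
begin

text \<open>Discretized sequence: a_n = d_n, a_i = min (a_(i+1) - 1) d_i. Values may be
  non-positive, hence int.\<close>
fun discretize :: "nat list \<Rightarrow> int list" where
  "discretize [] = []"
| "discretize [x] = [int x]"
| "discretize (x # y # zs) =
     (let r = discretize (y # zs) in min (hd r - 1) (int x) # r)"

text \<open>D given as a list (indices 0..n-1), A = discretize D, T a set of naturals.
  M uses every element (index) of D, A, T exactly once: D index i is matched with
  A index sigma i and T element g i, with sigma, g bijections.\<close>
definition pos_match :: "nat list \<Rightarrow> nat set \<Rightarrow> bool" where
  "pos_match D T \<longleftrightarrow>
     (let A = discretize D; n = length D in
      \<exists>\<sigma> g. bij_betw \<sigma> {..<n} {..<n} \<and> bij_betw g {..<n} T \<and>
        (\<forall>i<n. A ! (\<sigma> i) \<le> int (D ! i) \<and> int (g i) \<le> int (D ! i) + A ! (\<sigma> i)))"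

definition two_visits :: "nat list \<Rightarrow> bool" where
  "two_visits d \<longleftrightarrow>
     (let n = length d in
      \<exists>s :: nat \<Rightarrow> nat. (\<forall>p\<in>{1..2*n}. s p < n) \<and>
        (\<forall>i<n. \<exists>p q. 1 \<le> p \<and> p < q \<and> q \<le> 2*n \<and>
           {x\<in>{1..2*n}. s x = i} = {p, q} \<and> p \<le> d ! i \<and> q \<le> p + d ! i))"

text \<open>Registers (direct access) and a memory (indirect access). Unit-cost RAMs
  with only +, - (no multiplication) are polynomially equivalent to Turing machines.\<close>
datatype instr =
    RConst nat nat
  | RAdd nat nat nat
  | RSub nat nat nat      \<comment> \<open>reg r := reg s - reg t (truncated)\<close>
  | RLoad nat nat
  | RStore nat nat
  | RJz nat nat
  | RHalt

type_synonym config = "nat \<times> (nat \<Rightarrow> nat) \<times> (nat \<Rightarrow> nat)"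

definition halted :: "instr list \<Rightarrow> config \<Rightarrow> bool" where
  "halted prog c \<longleftrightarrow> (fst c \<ge> length prog \<or> prog ! fst c = RHalt)"

definition step :: "instr list \<Rightarrow> config \<Rightarrow> config" where
  "step prog c = (if halted prog c then c else
     (case c of (pc, reg, mem) \<Rightarrow>
       (case prog ! pc of
          RConst r k \<Rightarrow> (Suc pc, reg(r := k), mem)
        | RAdd r s t \<Rightarrow> (Suc pc, reg(r := reg s + reg t), mem)
        | RSub r s t \<Rightarrow> (Suc pc, reg(r := reg s - reg t), mem)
        | RLoad r s \<Rightarrow> (Suc pc, reg(r := mem (reg s)), mem)
        | RStore r s \<Rightarrow> (Suc pc, reg, mem(reg s := reg r))
        | RJz r l \<Rightarrow> (if reg r = 0 then l else Suc pc, reg, mem)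
        | RHalt \<Rightarrow> (pc, reg, mem))))"

definition exec :: "instr list \<Rightarrow> nat \<Rightarrow> config \<Rightarrow> config" where
  "exec prog t c = (step prog ^^ t) c"

definition init :: "nat list \<Rightarrow> config" where
  "init xs = (0, \<lambda>_. 0,
     \<lambda>a. if a = 0 then length xs else if a \<le> length xs then xs ! (a - 1) else 0)"

definition ram_output :: "config \<Rightarrow> nat list" where
  "ram_output c = (case c of (pc, reg, mem) \<Rightarrow> map (\<lambda>j. mem (Suc j)) [0..<mem 0])"

fun bitlen :: "nat \<Rightarrow> nat" where
  "bitlen n = (if n = 0 then 0 else Suc (bitlen (n div 2)))"

definition enc_size :: "nat list \<Rightarrow> nat" where
  "enc_size xs = (\<Sum>x\<leftarrow>xs. bitlen x + 1)"

text \<open>Encoding of a Position Matching instance (D, T) where T is listed by ts.\<close>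
definition enc_pm :: "nat list \<Rightarrow> nat list \<Rightarrow> nat list" where
  "enc_pm D ts = length D # D @ ts"

end

theory Submission
  imports Defs "HOL-Combinatorics.Transposition"
begin

text \<open>In a 2-Visits schedule mark the first visit of every node. A node \<open>d\<close> may visit an unordered
  pair of positions as soon as one of them, \<open>a\<close>, is at most \<open>d\<close> and the other at most \<open>a + d\<close>, so an
  exchange argument moves the marked visits to the discretized positions \<open>A\<close>. Hence 2-Visits is
  Position Matching with \<open>T = [2n] - A\<close>. A general instance with all \<open>d \<le> e\<close> is brought into this
  form by shifting \<open>D\<close> by a large \<open>c\<close> and \<open>T\<close> by \<open>2c\<close> and adding two kinds of nodes: low nodes,
  whose sums stay below all shifted targets, fill the remaining positions up to some \<open>B \<ge> c + e\<close>,
  and for each non-target in \<open>{B<..2*B}\<close> a high node occupies that position; the high nodes are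
  kept busy by the positions beyond \<open>2 * B\<close>, which nothing else reaches.

  For the size to be polynomial, \<open>e\<close> must be. A gap of more than \<open>n\<close> between consecutive elements
  of \<open>D\<close> separates the matching into two independent parts, and the gap can be shrunk to \<open>n\<close>
  together with the corresponding gap between the sums \<open>d + a\<close>; afterwards \<open>e \<le> n\<^sup>2\<close>.\<close>

subsection \<open>Discretized sequences\<close>

lemma length_discretize [simp]: "length (discretize D) = length D"
  by (induction D rule: discretize.induct) (auto simp: Let_def)

lemma discretize_eq_Nil [simp]: "discretize D = [] \<longleftrightarrow> D = []"
  by (metis length_0_conv length_discretize)

lemma discretize_Cons:
  "D \<noteq> [] \<Longrightarrow> discretize (x # D) = min (hd (discretize D) - 1) (int x) # discretize D"
  by (cases D) (auto simp: Let_def)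

text \<open>The hypothesis makes the minimum at the junction pick \<open>last D1\<close>, exactly as
  if the list ended there.\<close>

lemma discretize_append:
  assumes "D1 \<noteq> [] \<Longrightarrow> D2 \<noteq> [] \<Longrightarrow> int (last D1) < hd (discretize D2)"
  shows "discretize (D1 @ D2) = discretize D1 @ discretize D2"
  using assms
proof (induction D1)
  case (Cons x D1)
  show ?case
  proof (cases "D1 = []")
    case True
    then show ?thesis using Cons.prems by (cases "D2 = []") (auto simp: discretize_Cons)
  next
    case False
    then have "discretize (D1 @ D2) = discretize D1 @ discretize D2"
      using Cons by auto
    then show ?thesis using False by (simp add: discretize_Cons)
  qed
qed auto

lemma discretize_shift:
  "discretize (map (\<lambda>d. d + c) D) = map (\<lambda>a. a + int c) (discretize D)"
proof (induction D)
  case (Cons x D)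
  then show ?case by (cases "D = []") (auto simp: discretize_Cons hd_map)
qed auto

lemma discretize_le: "i < length D \<Longrightarrow> discretize D ! i \<le> int (D ! i)"
proof (induction D arbitrary: i)
  case (Cons x D)
  then show ?case by (cases "D = []"; cases i) (auto simp: discretize_Cons)
qed auto

text \<open>Unrolling the recursion, entry \<open>k\<close> is the minimum of
  \<open>D ! j - (j - k)\<close> over \<open>j \<ge> k\<close>; the witness is a minimizing
  index.\<close>

lemma discretize_attained:
  "k < length D \<Longrightarrow> \<exists>j\<ge>k. j < length D \<and> discretize D ! k = int (D ! j) - int (j - k)"
proof (induction D arbitrary: k)
  case (Cons x D)
  show ?case
  proof (cases "D = []")
    case True
    then show ?thesis using Cons.prems by auto
  next
    case False
    show ?thesis
    proof (cases k)
      case 0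
      obtain j where j: "j < length D" "discretize D ! 0 = int (D ! j) - int j"
        using Cons.IH[of 0] False by auto
      have hd: "hd (discretize D) = discretize D ! 0" using False by (simp add: hd_conv_nth)
      show ?thesis
      proof (cases "hd (discretize D) - 1 \<le> int x")
        case True
        then show ?thesis using 0 False j hd
          by (intro exI[of _ "Suc j"]) (auto simp: discretize_Cons)
      next
        case F: False
        then show ?thesis using 0 False by (intro exI[of _ 0]) (auto simp: discretize_Cons)
      qed
    next
      case (Suc k')
      then obtain j where "j \<ge> k'" "j < length D" "discretize D ! k' = int (D ! j) - int (j - k')"
        using Cons.IH[of k'] Cons.prems by auto
      then show ?thesis using Suc False by (intro exI[of _ "Suc j"]) (auto simp: discretize_Cons)
    qed
  qed
qed auto

lemma discretize_ge:
  assumes "k < length D" "\<forall>d\<in>set D. lo \<le> d"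
  shows "int lo - int (length D) < discretize D ! k"
proof -
  obtain j where j: "j\<ge>k" "j < length D" "discretize D ! k = int (D ! j) - int (j - k)"
    using discretize_attained[OF assms(1)] by blast
  have "lo \<le> D ! j" using assms(2) j(2) by auto
  then show ?thesis using j by linarith
qed

lemma sorted_discretize: "sorted_wrt (<) (discretize D)"
proof (induction D)
  case (Cons x D)
  show ?case
  proof (cases "D = []")
    case False
    then obtain y ys where e: "discretize D = y # ys"
      by (cases "discretize D") auto
    with Cons False show ?thesis by (auto simp: discretize_Cons)
  qed auto
qed auto

lemma distinct_discretize: "distinct (discretize D)"
  using sorted_discretize strict_sorted_iff by blast

lemma discretize_replicate:
  "discretize (replicate l M) = map (\<lambda>i. int M - int l + 1 + int i) [0..<l]"
proof (induction l)
  case (Suc l)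
  show ?case
  proof (cases "l = 0")
    case False
    then have "hd (discretize (replicate l M)) = int M - int l + 1"
      by (simp add: Suc hd_map)
    then have "discretize (replicate (Suc l) M) = (int M - int l) # discretize (replicate l M)"
      using False by (simp add: discretize_Cons)
    also have "\<dots> = map (\<lambda>i. int M - int (Suc l) + 1 + int i) [0..<Suc l]"
      unfolding Suc upt_conv_Cons[OF zero_less_Suc] map_Suc_upt[symmetric] by simp
    finally show ?thesis .
  qed auto
qed auto

lemma discretize_strict_sorted:
  "sorted_wrt (<) D \<Longrightarrow> discretize D = map int D"
proof (induction D)
  case (Cons x D)
  then show ?case by (cases D) (auto simp: discretize_Cons)
qed auto

subsection \<open>The exchange argument\<close>

text \<open>\<open>w i\<close> is the marked visit of node \<open>i\<close> and \<open>w (n + i)\<close> the other one. The marked visit need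
  not be the first one; this makes the exchange argument free of case distinctions.\<close>

definition marked_schedule :: "nat list \<Rightarrow> (nat \<Rightarrow> nat) \<Rightarrow> bool" where
  "marked_schedule D w \<longleftrightarrow> bij_betw w {..<2 * length D} {1..2 * length D} \<and>
     (\<forall>i<length D. w i \<le> D ! i \<and> w (length D + i) \<le> w i + D ! i)"

text \<open>If the marked visit comes second, both visits lie at positions up to
  \<open>D ! i\<close>, and then the pair also meets its deadlines in chronological order.\<close>

lemma two_visits_iff_marked_schedule: "two_visits D \<longleftrightarrow> (\<exists>w. marked_schedule D w)"
proof
  define n where "n = length D"
  assume "two_visits D"
  then obtain s where "\<forall>i<n. \<exists>p q. 1 \<le> p \<and> p < q \<and> q \<le> 2*n \<and>
           {x\<in>{1..2*n}. s x = i} = {p, q} \<and> p \<le> D ! i \<and> q \<le> p + D ! i"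
    unfolding two_visits_def Let_def n_def[symmetric] by (elim exE conjE)
  then have "\<exists>p q. \<forall>i<n. 1 \<le> p i \<and> p i < q i \<and> q i \<le> 2*n \<and>
           {x\<in>{1..2*n}. s x = i} = {p i, q i} \<and> p i \<le> D ! i \<and> q i \<le> p i + D ! i"
    by (simp only: choice_iff')
  then obtain p q where pq: "\<And>i. i < n \<Longrightarrow> 1 \<le> p i \<and> p i < q i \<and> q i \<le> 2*n \<and>
           {x\<in>{1..2*n}. s x = i} = {p i, q i} \<and> p i \<le> D ! i \<and> q i \<le> p i + D ! i"
    by blast
  define w where "w y = (if y < n then p y else q (y - n))" for y
  have s': "s (p i) = i" "s (q i) = i" if "i < n" for i using pq[OF that] by blast+
  have "inj_on w {..<2*n}"
  proof (rule inj_onI)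
    fix x y assume xy: "x \<in> {..<2*n}" "y \<in> {..<2*n}" "w x = w y"
    define x' y' where "x' = (if x < n then x else x - n)" and "y' = (if y < n then y else y - n)"
    have "x' < n" "y' < n" using xy unfolding x'_def y'_def by auto
    moreover have "s (w x) = x'" "s (w y) = y'"
      using xy(1,2) s' by (auto simp: w_def x'_def y'_def)
    ultimately have "x' = y'" "p x' \<noteq> q x'" using xy(3) pq[of x'] by auto
    then show "x = y" using xy unfolding w_def x'_def y'_def by (auto split: if_splits)
  qed
  moreover have "w ` {..<2*n} \<subseteq> {1..2*n}"
  proof
    fix z assume "z \<in> w ` {..<2*n}"
    then obtain y where y: "y < 2*n" "z = w y" by auto
    then show "z \<in> {1..2*n}" using pq[of y] pq[of "y - n"]
      by (cases "y < n") (fastforce simp: w_def)+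
  qed
  ultimately have "bij_betw w {..<2*n} {1..2*n}"
    by (metis bij_betw_def card_atLeastAtMost card_image card_lessThan card_subset_eq diff_Suc_1
        finite_atLeastAtMost)
  moreover have "\<forall>i<n. w i \<le> D ! i \<and> w (n + i) \<le> w i + D ! i"
    using pq by (auto simp: w_def)
  ultimately show "\<exists>w. marked_schedule D w" unfolding marked_schedule_def n_def by blast
next
  define n where "n = length D"
  assume "\<exists>w. marked_schedule D w"
  then obtain w where bij: "bij_betw w {..<2*n} {1..2*n}"
    and w: "\<And>i. i < n \<Longrightarrow> w i \<le> D ! i \<and> w (n + i) \<le> w i + D ! i"
    unfolding marked_schedule_def n_def by blast
  define f where "f = inv_into {..<2*n} w"
  define s where "s x = (if f x < n then f x else f x - n)" for x
  have f: "f (w y) = y" if "y < 2*n" for y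
    using that bij unfolding f_def bij_betw_def by (simp add: inv_into_f_f)
  have f2: "f x < 2*n" "w (f x) = x" if "x \<in> {1..2*n}" for x
    using that bij unfolding f_def bij_betw_def
    by (metis inv_into_into lessThan_iff, metis f_inv_into_f)
  have rng: "1 \<le> w y" "w y \<le> 2*n" if "y < 2*n" for y
    using bij_betwE[OF bij] that by auto
  have "\<exists>p q. 1 \<le> p \<and> p < q \<and> q \<le> 2*n \<and>
           {x\<in>{1..2*n}. s x = i} = {p, q} \<and> p \<le> D ! i \<and> q \<le> p + D ! i" if i: "i < n" for i
  proof -
    have S: "{x\<in>{1..2*n}. s x = i} = {w i, w (n + i)}"
    proof (intro set_eqI iffI)
      fix x assume "x \<in> {x\<in>{1..2*n}. s x = i}"
      then have "x \<in> {1..2*n}" "f x = i \<or> f x = n + i" unfolding s_def by (auto split: if_splits)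
      then show "x \<in> {w i, w (n + i)}" using f2(2)[of x] by auto
    next
      fix x assume "x \<in> {w i, w (n + i)}"
      then show "x \<in> {x\<in>{1..2*n}. s x = i}" using i f rng by (auto simp: s_def)
    qed
    have ne: "w i \<noteq> w (n + i)" using f[of i] f[of "n + i"] i
      by (metis add_less_cancel_left mult_2 not_add_less1 trans_less_add1)
    have "1 \<le> w i" "1 \<le> w (n+i)" "w i \<le> 2*n" "w (n+i) \<le> 2*n" using rng i by auto
    then have "1 \<le> min (w i) (w (n + i)) \<and> min (w i) (w (n + i)) < max (w i) (w (n + i)) \<and>
        max (w i) (w (n + i)) \<le> 2*n \<and> {w i, w (n + i)} = {min (w i) (w (n + i)), max (w i) (w (n + i))} \<and>
        min (w i) (w (n + i)) \<le> D ! i \<and> max (w i) (w (n + i)) \<le> min (w i) (w (n + i)) + D ! i"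
      using w[OF i] ne by (auto simp: min_def max_def)
    then show ?thesis unfolding S by blast
  qed
  moreover have "\<forall>p\<in>{1..2*n}. s p < n" using f2 unfolding s_def by fastforce
  ultimately show "two_visits D"
    unfolding two_visits_def Let_def n_def[symmetric] by (intro exI[of _ s] conjI allI impI)
qed

text \<open>Take a marked schedule with the largest sum of marked positions. A discretized position
  without a mark would allow a swap that raises this sum, so all of them are marked, and counting
  excludes any other mark.\<close>

lemma marked_schedule_discretize:
  assumes sorted: "sorted D" and rng: "set (discretize D) \<subseteq> {1..2 * int (length D)}"
    and ex: "\<exists>w. marked_schedule D w"
  shows "\<exists>w. marked_schedule D w \<and> int ` w ` {..<length D} = set (discretize D)"
proof -
  define n where "n = length D"
  define A where "A = discretize D"
  obtain w0 where w0: "marked_schedule D w0" using ex ..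
  define \<phi> where "\<phi> w = (\<Sum>i<n. w i)" for w :: "nat \<Rightarrow> nat"
  \<comment> \<open>The deadlines bound the sum, so a maximum exists.\<close>
  have "\<forall>w. marked_schedule D w \<longrightarrow> \<phi> w < Suc (\<Sum>i<n. D ! i)"
    unfolding marked_schedule_def \<phi>_def n_def by (auto intro!: le_imp_less_Suc sum_mono)
  then obtain w where w: "marked_schedule D w"
    and max: "\<And>w'. marked_schedule D w' \<Longrightarrow> \<phi> w' \<le> \<phi> w"
    using ex_has_greatest_nat[of "marked_schedule D" w0 \<phi>] w0 by blast
  have bij: "bij_betw w {..<2*n} {1..2*n}"
    and wle: "\<And>i. i < n \<Longrightarrow> w i \<le> D ! i \<and> w (n + i) \<le> w i + D ! i"
    using w unfolding marked_schedule_def n_def by blast+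
  have inj: "inj_on w {..<2*n}" using bij bij_betw_def by blast
  have "A ! k \<in> int ` w ` {..<n}" if k: "k < n" for k
  proof (rule ccontr)
    assume no: "A ! k \<notin> int ` w ` {..<n}"
    have Arng: "A ! k \<in> {1..2 * int n}"
      using rng k nth_mem[of k A] unfolding A_def n_def by (simp add: subset_iff)
    define a where "a = nat (A ! k)"
    have a: "int a = A ! k" "a \<in> {1..2*n}" using Arng unfolding a_def by auto
    have aw: "a \<noteq> w i" if "i < n" for i using no a(1) that by (metis imageI lessThan_iff)
    obtain j where j: "j \<ge> k" "j < n" "A ! k = int (D ! j) - int (j - k)"
      using discretize_attained[of k D] k unfolding A_def n_def by auto
    have Dk: "A ! k \<le> int (D ! k)" using discretize_le k unfolding A_def n_def by blast
    text \<open>Pigeonhole: the nodes \<open>k..j\<close> cannot all have their marked visits in the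
      \<open>j - k\<close> positions from \<open>a + 1\<close> to \<open>D ! j\<close>.\<close>
    have "\<exists>i\<in>{k..j}. w i < a"
    proof (rule ccontr)
      assume neg: "\<not> (\<exists>i\<in>{k..j}. w i < a)"
      have "w ` {k..j} \<subseteq> {a+1..D ! j}"
      proof
        fix z assume "z \<in> w ` {k..j}"
        then obtain i where i: "i \<in> {k..j}" "z = w i" by auto
        then have "i < n" using j by auto
        then have "w i \<le> D ! i" "D ! i \<le> D ! j" "w i \<noteq> a" "\<not> w i < a"
          using i j wle neg aw[of i] sorted by (auto simp: sorted_iff_nth_mono n_def)
        then show "z \<in> {a+1..D ! j}" using i by auto
      qed
      then have "card (w ` {k..j}) \<le> D ! j - a"
        by (metis Suc_eq_plus1 card_atLeastAtMost card_mono diff_Suc_Suc finite_atLeastAtMost)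
      moreover have "{k..j} \<subseteq> {..<2*n}" using j(2) by auto
      then have "card (w ` {k..j}) = Suc j - k"
        using card_image[OF inj_on_subset[OF inj]] by simp
      ultimately show False using j a by linarith
    qed
    then obtain i where i: "i \<in> {k..j}" "w i < a" by blast
    then have i': "i < n" "a \<le> D ! i"
    proof -
      show "i < n" using i j by auto
      then have "D ! k \<le> D ! i" using i sorted by (auto simp: sorted_iff_nth_mono n_def)
      then show "a \<le> D ! i" using Dk a by linarith
    qed
    obtain y where y: "y < 2*n" "w y = a" using bij a(2) unfolding bij_betw_def
      by (metis imageE lessThan_iff)
    with aw have "\<not> y < n" by auto
    \<comment> \<open>Position \<open>a\<close> carries the unmarked visit \<open>y\<close> of some
      node. After the swap the mark of \<open>i\<close> is later but still in time, and the owner of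
      \<open>y\<close> has its unmarked visit earlier; both remain valid even if they are the same
      node.\<close>
    define w' where "w' = w \<circ> transpose i y"
    have w': "w' x = (if x = i then a else if x = y then w i else w x)" for x
      using y by (auto simp: w'_def transpose_def)
    have "bij_betw (transpose i y) {..<2*n} {..<2*n}"
      using i' y(1) by (intro bij_betw_byWitness[where f' = "transpose i y"]) (auto simp: transpose_def)
    then have "bij_betw w' {..<2*n} {1..2*n}"
      unfolding w'_def using bij bij_betw_trans by blast
    moreover have "w' m \<le> D ! m \<and> w' (n + m) \<le> w' m + D ! m" if "m < n" for m
      using wle[OF that] wle[OF i'(1)] i' i(2) \<open>\<not> y < n\<close> that y(2) by (auto simp: w')
    ultimately have "marked_schedule D w'" unfolding marked_schedule_def n_def by blast
    then have "\<phi> w' \<le> \<phi> w" by (rule max)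
    moreover have "\<phi> w < \<phi> w'" unfolding \<phi>_def
      by (rule sum_strict_mono_ex1) (use i' i(2) \<open>\<not> y < n\<close> in \<open>auto simp: w' intro!: bexI[of _ i]\<close>)
    ultimately show False by simp
  qed
  then have sub: "set A \<subseteq> int ` w ` {..<n}"
    unfolding A_def n_def by (auto simp: in_set_conv_nth)
  have "card (set A) = n" unfolding A_def n_def using distinct_discretize
    by (simp add: distinct_card)
  moreover have "card (int ` w ` {..<n}) \<le> n"
    by (metis card_image_le card_lessThan finite_imageI finite_lessThan order_trans)
  ultimately have "set A = int ` w ` {..<n}" using sub by (intro card_seteq) auto
  then show ?thesis using w unfolding A_def n_def by auto
qed

subsection \<open>Shrinking a gap\<close>

text \<open>Naming targets by their index in \<open>ts\<close> turns a matching into two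
  permutations, which can be reused unchanged for another instance of the same length.\<close>

lemma pos_match_set_iff:
  assumes "distinct ts" "length ts = length D"
  shows "pos_match D (set ts) \<longleftrightarrow>
    (\<exists>\<sigma> \<tau>. bij_betw \<sigma> {..<length D} {..<length D} \<and> bij_betw \<tau> {..<length D} {..<length D} \<and>
      (\<forall>i<length D. discretize D ! \<sigma> i \<le> int (D ! i) \<and>
         int (ts ! \<tau> i) \<le> int (D ! i) + discretize D ! \<sigma> i))" (is "_ \<longleftrightarrow> (\<exists>\<sigma> \<tau>. ?R \<sigma> \<tau>)")
proof
  have b: "bij_betw ((!) ts) {..<length D} (set ts)"
    using assms by (intro bij_betw_nth) auto
  {
    assume "pos_match D (set ts)"
    then obtain \<sigma> g where \<sigma>: "bij_betw \<sigma> {..<length D} {..<length D}"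
      and g: "bij_betw g {..<length D} (set ts)"
      and r: "\<forall>i<length D. discretize D ! \<sigma> i \<le> int (D ! i) \<and>
         int (g i) \<le> int (D ! i) + discretize D ! \<sigma> i"
      unfolding pos_match_def Let_def by blast
    define \<tau> where "\<tau> = inv_into {..<length D} ((!) ts) \<circ> g"
    have "bij_betw \<tau> {..<length D} {..<length D}"
      unfolding \<tau>_def using g b bij_betw_inv_into bij_betw_trans by blast
    moreover have "ts ! \<tau> i = g i" if "i < length D" for i
      using that bij_betwE[OF g] bij_betw_inv_into_right[OF b] by (simp add: \<tau>_def)
    ultimately show "\<exists>\<sigma> \<tau>. ?R \<sigma> \<tau>" using \<sigma> r by (intro exI[of _ \<sigma>] exI[of _ \<tau>]) simp
  next
    assume "\<exists>\<sigma> \<tau>. ?R \<sigma> \<tau>"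
    then obtain \<sigma> \<tau> where R: "?R \<sigma> \<tau>" by blast
    then have "bij_betw \<tau> {..<length D} {..<length D}" by blast
    then have "bij_betw ((!) ts \<circ> \<tau>) {..<length D} (set ts)" using b by (rule bij_betw_trans)
    then show "pos_match D (set ts)" unfolding pos_match_def Let_def using R
      by (intro exI[of _ \<sigma>] exI[of _ "(!) ts \<circ> \<tau>"]) simp
  }
qed

text \<open>If the first \<open>k\<close> nodes lie below all later slots, then by counting a matching respects the
  split at \<open>k\<close>, so only pairs on the same side of the split have to be compared.\<close>
lemma pos_match_transfer:
  assumes len: "length D' = length D" "length ts = length D" "length ts' = length D"
    and dist: "distinct ts" "distinct ts'"
    and split: "\<And>i j. i < k \<Longrightarrow> k \<le> j \<Longrightarrow> j < length D \<Longrightarrow> int (D ! i) < discretize D ! j"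
    and k: "k \<le> length D"
    and tr: "\<And>i j e. i < length D \<Longrightarrow> j < length D \<Longrightarrow> e < length D \<Longrightarrow> (i < k \<longleftrightarrow> j < k) \<Longrightarrow>
      discretize D ! j \<le> int (D ! i) \<Longrightarrow> int (ts ! e) \<le> int (D ! i) + discretize D ! j \<Longrightarrow>
      discretize D' ! j \<le> int (D' ! i) \<and> int (ts' ! e) \<le> int (D' ! i) + discretize D' ! j"
    and pm: "pos_match D (set ts)"
  shows "pos_match D' (set ts')"
proof -
  obtain \<sigma> \<tau> where \<sigma>: "bij_betw \<sigma> {..<length D} {..<length D}"
    and \<tau>: "bij_betw \<tau> {..<length D} {..<length D}"
    and r: "\<And>i. i < length D \<Longrightarrow> discretize D ! \<sigma> i \<le> int (D ! i) \<and>
         int (ts ! \<tau> i) \<le> int (D ! i) + discretize D ! \<sigma> i"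
    using pm unfolding pos_match_set_iff[OF dist(1) len(2)] by blast
  have lt: "\<sigma> i < length D" "\<tau> i < length D" if "i < length D" for i
    using that bij_betwE[OF \<sigma>] bij_betwE[OF \<tau>] by auto
  have inj: "inj_on \<sigma> {..<length D}" using \<sigma> bij_betw_def by blast
  have 1: "\<sigma> i < k" if "i < k" for i
    using split[OF that, of "\<sigma> i"] r[of i] lt[of i] that k by (meson leD leI less_le_trans)
  \<comment> \<open>By injectivity the first \<open>k\<close> nodes use up the first
    \<open>k\<close> slots, so none is left for a later node.\<close>
  then have img: "\<sigma> ` {..<k} = {..<k}"
    using inj_on_subset[OF inj, of "{..<k}"] k by (intro endo_inj_surj) auto
  have 2: "i < k" if "i < length D" "\<sigma> i < k" for i
  proof -
    obtain i' where "i' < k" "\<sigma> i' = \<sigma> i" using img \<open>\<sigma> i < k\<close> by (metis imageE lessThan_iff)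
    then show ?thesis using inj that(1) k by (auto dest: inj_onD)
  qed
  have "discretize D' ! \<sigma> i \<le> int (D' ! i) \<and> int (ts' ! \<tau> i) \<le> int (D' ! i) + discretize D' ! \<sigma> i"
    if i: "i < length D" for i
    using tr[OF i lt[OF i], of] r[OF i] 1[of i] 2[OF i] by blast
  then show ?thesis unfolding pos_match_set_iff[OF dist(2) len(3)[folded len(1)]] len(1)
    using \<sigma> \<tau> by blast
qed

definition shrink_dist :: "nat \<Rightarrow> nat \<Rightarrow> nat \<Rightarrow> nat" where
  "shrink_dist hi g d = (if d \<le> hi then d else d - g)"

text \<open>A target in the gap between \<open>2 * hi\<close> and the sums above it may go anywhere in that gap;
  its index \<open>k\<close> is used to keep the targets distinct.\<close>
definition shrink_target :: "nat \<Rightarrow> nat \<Rightarrow> nat \<Rightarrow> nat \<Rightarrow> nat \<Rightarrow> nat" where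
  "shrink_target n hi g k t =
     (if t \<le> 2 * hi then t else if t \<le> 2 * hi + (2 * g + n) then 2 * hi + (k + 1) else t - 2 * g)"

definition shrink_targets :: "nat \<Rightarrow> nat \<Rightarrow> nat list \<Rightarrow> nat list" where
  "shrink_targets hi g ts =
     map (\<lambda>k. shrink_target (length ts) hi g k (ts ! k)) [0..<length ts]"

lemma length_shrink_targets [simp]: "length (shrink_targets hi g ts) = length ts"
  by (simp add: shrink_targets_def)

lemma nth_shrink_targets:
  "k < length ts \<Longrightarrow> shrink_targets hi g ts ! k = shrink_target (length ts) hi g k (ts ! k)"
  by (simp add: shrink_targets_def)

text \<open>The three cases of \<open>shrink_target\<close> have disjoint ranges: up to
  \<open>2*hi\<close>, from there up to \<open>2*hi + n\<close>, and beyond. In the middle range the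
  index separates.\<close>

lemma distinct_shrink_targets:
  assumes "distinct ts" shows "distinct (shrink_targets hi g ts)"
proof -
  have "i = j" if "shrink_target n hi g i t = shrink_target n hi g j t'" "t = t' \<longleftrightarrow> i = j"
    "i < n" "j < n" for n i j t t'
    using that by (auto simp: shrink_target_def split: if_splits)
  from this[where t = "ts ! _" and t' = "ts ! _"] show ?thesis using assms
    unfolding distinct_conv_nth length_shrink_targets by (metis nth_shrink_targets)
qed

lemma shrink_targets_pos: "\<forall>t\<in>set ts. 0 < t \<Longrightarrow> \<forall>t\<in>set (shrink_targets hi g ts). 0 < t"
  by (auto simp: shrink_targets_def shrink_target_def)

lemma sorted_shrink_dist:
  assumes "sorted D" "\<forall>d\<in>set D. d \<le> hi \<or> hi + g + n \<le> d"
  shows "sorted (map (shrink_dist hi g) D)"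
  unfolding sorted_map
proof (rule sorted_wrt_mono_rel[OF _ assms(1)])
  fix x y assume "x \<in> set D" "y \<in> set D" "x \<le> y"
  then show "shrink_dist hi g x \<le> shrink_dist hi g y"
    using assms(2)[rule_format, of x] assms(2)[rule_format, of y] by (auto simp: shrink_dist_def)
qed

text \<open>With \<open>n = length D\<close>, sums on the lower side are at most
  \<open>2*hi\<close>; on the upper side they exceed \<open>2*hi + 2*g + n\<close> before and
  \<open>2*hi + n\<close> after shrinking, and all upper nodes and slots move by the same
  \<open>g\<close>. So every comparison within one side keeps its truth value.\<close>

lemma pos_match_shrink:
  assumes sorted: "sorted D" and len: "length ts = length D" and dist: "distinct ts"
    and gap: "\<forall>d\<in>set D. d \<le> hi \<or> hi + g + length D \<le> d"
  shows "pos_match (map (shrink_dist hi g) D) (set (shrink_targets hi g ts)) \<longleftrightarrow>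
    pos_match D (set ts)"
proof -
  define n where "n = length D"
  define D1 where "D1 = takeWhile (\<lambda>d. d \<le> hi) D"
  define D2 where "D2 = dropWhile (\<lambda>d. d \<le> hi) D"
  define D2' where "D2' = map (\<lambda>d. d - g) D2"
  define k where "k = length D1"
  have D: "D = D1 @ D2" by (simp add: D1_def D2_def)
  have k: "k \<le> n" by (simp add: n_def D k_def)
  have D1: "\<forall>d\<in>set D1. d \<le> hi" using set_takeWhileD by (fastforce simp: D1_def)
  have D2: "\<forall>d\<in>set D2. hi + g + n \<le> d"
  proof
    fix d assume d: "d \<in> set D2"
    then have "D2 \<noteq> []" by auto
    then have "\<not> hd D2 \<le> hi" using hd_dropWhile[of "\<lambda>d. d \<le> hi" D] by (simp add: D2_def)
    moreover have "hd D2 \<le> d" using d sorted unfolding D sorted_append by (cases D2) auto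
    moreover have "d \<in> set D" using d by (simp add: D)
    ultimately show "hi + g + n \<le> d" using gap unfolding n_def by fastforce
  qed
  define D' where "D' = map (shrink_dist hi g) D"
  have D': "D' = D1 @ D2'" unfolding D'_def D2'_def D map_append
  proof (intro arg_cong2[of _ _ _ _ "(@)"])
    show "map (shrink_dist hi g) D1 = D1"
      using D1 by (intro map_idI) (simp add: shrink_dist_def)
    show "map (shrink_dist hi g) D2 = map (\<lambda>d. d - g) D2"
      using D2 gap by (auto simp: shrink_dist_def D n_def) 
  qed
  have D2eq: "D2 = map (\<lambda>d. d + g) D2'"
    using D2 by (auto simp: D2'_def intro!: map_idI[symmetric])
  then have A2: "discretize D2 = map (\<lambda>a. a + int g) (discretize D2')"
    using discretize_shift[of g D2'] by simp
  \<comment> \<open>A gap of \<open>n\<close> must remain because discretizing can lower entries by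
    almost \<open>n\<close>; it keeps the upper slots above \<open>hi\<close>.\<close>
  have D2'_ge: "\<forall>d\<in>set D2'. hi + n \<le> d" using D2 by (auto simp: D2'_def)
  have len2: "length D2' = n - k" by (simp add: D2'_def n_def k_def D)
  have A2_gt: "int hi < discretize D2' ! j" if "j < length D2'" for j
    using discretize_ge[OF that D2'_ge] k len2 by linarith
  have last: "int (last D1) \<le> int hi" if "D1 \<noteq> []" using D1 that by auto
  have hd2': "int hi < hd (discretize D2')" if "D2' \<noteq> []"
    using A2_gt[of 0] that by (simp add: hd_conv_nth)
  have hd2: "int hi < hd (discretize D2)" if "D2 \<noteq> []"
    using hd2' that by (force simp: A2 hd_map D2'_def)
  have A: "discretize D = discretize D1 @ discretize D2"
    unfolding D using order_le_less_trans[OF last hd2] by (intro discretize_append)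
  have A': "discretize D' = discretize D1 @ discretize D2'"
    unfolding D' using order_le_less_trans[OF last hd2'] by (intro discretize_append)
  have lo: "D ! i \<le> hi" "D' ! i = D ! i" "discretize D ! i \<le> int hi"
      "discretize D' ! i = discretize D ! i" if "i < k" for i
    using that D1 discretize_le[of i D1] nth_mem[of i D1] unfolding A A' unfolding D D'
    by (auto simp: nth_append k_def simp del: nth_mem)
  have up: "hi + g + n \<le> D ! i" "D' ! i = D ! i - g" "int hi + int g < discretize D ! i"
      "discretize D' ! i = discretize D ! i - int g" if "k \<le> i" "i < n" for i
  proof -
    have i: "i - k < length D2'" "i - k < length D2" using that len2 by (auto simp: D2'_def)
    show "hi + g + n \<le> D ! i" "D' ! i = D ! i - g" 
      using that i D2 nth_mem[OF i(2)] by (auto simp: D D' nth_append k_def D2'_def)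
    show "int hi + int g < discretize D ! i" "discretize D' ! i = discretize D ! i - int g"
      using that i A2_gt[OF i(1)] unfolding A A' A2 by (auto simp: nth_append k_def)
  qed
  define ts' where "ts' = shrink_targets hi g ts"
  have T: "int (ts' ! e) \<le> int (D' ! i) + discretize D' ! j \<longleftrightarrow>
      int (ts ! e) \<le> int (D ! i) + discretize D ! j"
    if "i < n" "j < n" "e < n" "i < k \<longleftrightarrow> j < k" for i j e
  proof (cases "i < k")
    case True
    then show ?thesis using lo[of i] lo[of j] that len
      by (auto simp: ts'_def nth_shrink_targets shrink_target_def n_def)
  next
    case False
    then show ?thesis using up[of i] up[of j] that len
      by (auto simp: ts'_def nth_shrink_targets shrink_target_def n_def)
  qed
  have A_le: "discretize D' ! j \<le> int (D' ! i) \<longleftrightarrow> discretize D ! j \<le> int (D ! i)"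
    if "i < n" "j < n" "i < k \<longleftrightarrow> j < k" for i j
    using lo[of i] lo[of j] up[of i] up[of j] that by (cases "i < k") auto
  have sp: "int (D ! i) < discretize D ! j" "int (D' ! i) < discretize D' ! j"
    if "i < k" "k \<le> j" "j < n" for i j
    using lo[of i] up[of j] that by auto
  have l: "length D' = n" "length ts' = n" "length D = n" "length ts = n"
    using len by (auto simp: D'_def ts'_def n_def)
  have d': "distinct ts'" using dist by (simp add: ts'_def distinct_shrink_targets)
  show ?thesis unfolding D'_def[symmetric] ts'_def[symmetric]
  proof
    assume "pos_match D' (set ts')"
    then show "pos_match D (set ts)"
      by (rule pos_match_transfer[where k = k, rotated -1]) (use l d' dist k sp T A_le in auto)
  next
    assume "pos_match D (set ts)"
    then show "pos_match D' (set ts')"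
      by (rule pos_match_transfer[where k = k, rotated -1]) (use l d' dist k sp T A_le in auto)
  qed
qed

subsection \<open>The 2-Visits instance\<close>

text \<open>Low nodes, shifted nodes of \<open>D\<close>, high nodes. The low nodes take the marked positions
  \<open>{e + 4*n<..3*e + 9*n}\<close> just below the shifted discretized sequence; the numbers are chosen such
  that these nodes reach every free position up to \<open>B\<close>.\<close>
definition pm_instance :: "nat list \<Rightarrow> nat \<Rightarrow> nat set \<Rightarrow> nat list" where
  "pm_instance D e T = (let n = length D; c = 3*e + 10*n; B = 4*e + 11*n in
     replicate (2*e + 5*n) (3*e + 9*n) @ map (\<lambda>d. d + c) D @
     filter (\<lambda>x. x \<notin> (\<lambda>t. 2*c + t) ` T) [B + 1..<2*B + 1])"

lemma sorted_wrt_less_nth_ge: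
  "sorted_wrt (<) (xs :: nat list) \<Longrightarrow> \<forall>x\<in>set xs. b \<le> x \<Longrightarrow> i < length xs \<Longrightarrow> b + i \<le> xs ! i"
proof (induction i)
  case (Suc i)
  then have "xs ! i < xs ! Suc i" by (intro sorted_wrt_nth_less) auto
  then show ?case using Suc by auto
qed auto

section \<open>Arithmetic of the constructed instance and both directions of its correctness\<close>

context
  fixes D :: "nat list" and e :: nat and T :: "nat set" and n l M c B h N :: nat and H :: "nat list" and A :: "int list"
  assumes A_def: "A = discretize D" and sortedD: "sorted D" and D_bounds: "\<forall>d\<in>set D. 0 < d \<and> d \<le> e"
    and T_sub: "T \<subseteq> {1..2 * (e + n)}" and card_T: "card T = n"
    and n_def: "n = length D" and l_def: "l = 2*e + 5*n" and M_def: "M = 3*e + 9*n" and c_def: "c = 3*e + 10*n"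
    and B_def: "B = 4*e + 11*n" and h_def: "h = 4*e + 10*n" and N_def: "N = 6*e + 16*n"
    and H_def: "H = filter (\<lambda>x. x \<notin> (\<lambda>t. 2*c + t) ` T) [B + 1..<2*B + 1]"
begin

lemmas params = l_def M_def c_def B_def h_def N_def

lemma pm_instance_eq: "pm_instance D e T = replicate l M @ map (\<lambda>d. d + c) D @ H"
  unfolding pm_instance_def Let_def H_def params n_def ..

lemma set_H: "set H = {B + 1..2*B} - (\<lambda>t. 2*c + t) ` T"
  unfolding H_def by (auto simp del: upt_Suc)

lemma sorted_H: "sorted_wrt (<) H"
  unfolding H_def by (intro sorted_wrt_filter sorted_wrt_upt)

text \<open>Since \<open>2*B = 2*c + 2*(e + n)\<close>, the shifted targets all lie in the interval
  from which \<open>H\<close> is cut, and exactly \<open>n\<close> of its \<open>B\<close> elements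
  are missing.\<close>

lemma length_H: "length H = h"
proof -
  have "card ((\<lambda>t. 2*c + t) ` T) = n" using card_T by (simp add: card_image)
  moreover have "(\<lambda>t. 2*c + t) ` T \<subseteq> {B + 1..2*B}" using T_sub by (auto simp: params)
  moreover have "finite T" using T_sub finite_subset by blast
  ultimately have "card (set H) = B - n" unfolding set_H by (subst card_Diff_subset) auto
  moreover have "distinct H" using sorted_H strict_sorted_iff by blast
  ultimately show ?thesis by (simp add: distinct_card params)
qed

text \<open>This lets a high node marked at \<open>H ! i\<close> reach position
  \<open>2*B + 1 + i\<close>.\<close>

lemma H_ge: "i < h \<Longrightarrow> B + 1 + i \<le> H ! i"
  by (rule sorted_wrt_less_nth_ge[OF sorted_H]) (auto simp: set_H length_H)

lemma length_pm_instance: "length (pm_instance D e T) = N"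
  by (simp add: pm_instance_eq length_H n_def[symmetric]) (simp add: params)

lemma sorted_pm_instance: "sorted (pm_instance D e T)"
proof -
  have "sorted (map (\<lambda>d. d + c) D)"
    using sortedD by (auto simp: sorted_map intro: sorted_wrt_mono_rel[of D "(\<le>)"])
  moreover have "sorted H" using sorted_H strict_sorted_iff by blast
  ultimately show ?thesis unfolding pm_instance_eq using D_bounds
    by (fastforce simp: sorted_append set_H params)
qed

lemma pm_instance_pos: "\<forall>y\<in>set (pm_instance D e T). 0 < y"
  unfolding pm_instance_eq using D_bounds by (auto simp: set_H params)

text \<open>Discretized entries may be negative but stay above \<open>-n\<close>; the margin
  \<open>c - M = n\<close> keeps them clear of the low block after shifting.\<close>

lemma A_bounds: "a \<in> set A \<Longrightarrow> int M < a + int c \<and> a + int c \<le> int B"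
proof -
  assume "a \<in> set A"
  then obtain i where i: "i < length D" "a = discretize D ! i"
    by (auto simp: A_def in_set_conv_nth)
  then have "D ! i \<le> e" using D_bounds by auto
  then show ?thesis
    using i discretize_le[of i D] discretize_ge[of i D 0] by (auto simp: n_def params)
qed

text \<open>The thresholds \<open>M\<close> and \<open>B\<close> separate the three blocks, so each
  is discretized on its own. The \<open>l\<close> copies of \<open>M\<close> spread over the
  interval that starts at \<open>M - l + 1 = e + 4*n + 1\<close>.\<close>

lemma discretize_pm_instance:
  "discretize (pm_instance D e T) =
     map (\<lambda>i. int (e + 4*n + 1 + i)) [0..<l] @ map (\<lambda>a. a + int c) A @ map int H"
proof -
  have hd: "hd (discretize H) > int B" if "H \<noteq> []"
  proof -
    have "hd H \<in> set H" using that by simp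
    then show ?thesis using that set_H discretize_strict_sorted[OF sorted_H] by (simp add: hd_map)
  qed
  have 1: "discretize (map (\<lambda>d. d + c) D @ H) = map (\<lambda>a. a + int c) A @ map int H" (is "_ = ?X")
  proof (subst discretize_append)
    assume ne: "map (\<lambda>d. d + c) D \<noteq> []" "H \<noteq> []"
    have "last D \<le> e" using ne D_bounds by auto
    then show "int (last (map (\<lambda>d. d + c) D)) < hd (discretize H)"
      using hd[OF ne(2)] ne by (simp add: last_map params)
  qed (simp add: A_def discretize_shift discretize_strict_sorted[OF sorted_H])
  have "\<forall>a\<in>set ?X. int M < a"
    by (auto simp: params set_H dest!: A_bounds)
  then have X: "int M < hd ?X" if "?X \<noteq> []" using that hd_in_set by blast
  have "discretize (pm_instance D e T) = discretize (replicate l M) @ ?X"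
    unfolding pm_instance_eq using X by (subst discretize_append) (auto simp: 1 A_def)
  then show ?thesis by (simp add: discretize_replicate params algebra_simps)
qed

lemma nth_pm_instance:
  "i < l \<Longrightarrow> pm_instance D e T ! i = M"
  "i < n \<Longrightarrow> pm_instance D e T ! (l + i) = D ! i + c"
  "i < h \<Longrightarrow> pm_instance D e T ! (l + n + i) = H ! i"
  unfolding pm_instance_eq by (auto simp: nth_append n_def)

lemma set_discretize_pm_instance:
  "set (discretize (pm_instance D e T)) =
     {int (e + 4*n) + 1..int M} \<union> (\<lambda>a. a + int c) ` set A \<union> int ` set H"
proof -
  have "set (map (\<lambda>i. int (e + 4*n + 1 + i)) [0..<l]) = {int (e + 4*n) + 1..int M}"
  proof (intro set_eqI iffI)
    fix x assume "x \<in> {int (e + 4*n) + 1..int M}"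
    then show "x \<in> set (map (\<lambda>i. int (e + 4*n + 1 + i)) [0..<l])"
      by (auto simp: params image_iff intro!: bexI[of _ "nat x - (e + 4*n + 1)"])
  qed (auto simp: params)
  then show ?thesis unfolding discretize_pm_instance set_append set_map Un_assoc by simp
qed

text \<open>Marks go to the discretized positions, with node \<open>i\<close> of \<open>D\<close> at
  its shifted partner \<open>A ! \<sigma> i\<close>. The other visits of low nodes, of nodes of
  \<open>D\<close> and of high nodes fill the free positions up to \<open>B\<close>, the shifted
  targets and the positions beyond \<open>2*B\<close>.\<close>

lemma two_visits_if_pos_match:
  assumes "pos_match D T" shows "two_visits (pm_instance D e T)"
proof -
  obtain \<sigma> g where \<sigma>: "bij_betw \<sigma> {..<n} {..<n}" and g: "bij_betw g {..<n} T"
    and r: "\<And>i. i < n \<Longrightarrow> A ! \<sigma> i \<le> int (D ! i) \<and> int (g i) \<le> int (D ! i) + A ! \<sigma> i"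
    using assms unfolding pos_match_def Let_def n_def A_def by blast
  have A\<sigma>: "A ! \<sigma> i \<in> set A" if "i < n" for i
    using that bij_betwE[OF \<sigma>] by (auto simp: n_def A_def)
  define AC where "AC = (\<lambda>a. nat (a + int c)) ` set A"
  have AC_sub: "AC \<subseteq> {M + 1..B}" by (auto simp: AC_def params dest!: A_bounds)
  have "inj_on (\<lambda>a. nat (a + int c)) (set A)"
    by (intro inj_onI) (auto simp: nat_eq_iff dest!: A_bounds)
  then have card_AC: "card AC = n"
    unfolding AC_def using distinct_discretize[of D] by (simp add: card_image distinct_card n_def A_def)
  \<comment> \<open>The positions up to \<open>B\<close> that carry no mark; their number
    \<open>e + 4*n + (B - M - n)\<close> is exactly \<open>l\<close>.\<close>
  define S where "S = {1..e + 4*n} \<union> ({M + 1..B} - AC)"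
  have "card S = card {1..e + 4*n} + card ({M + 1..B} - AC)"
    unfolding S_def by (rule card_Un_disjoint) (auto simp: params)
  also have "card ({M + 1..B} - AC) = card {M + 1..B} - card AC"
    using AC_sub finite_subset[OF AC_sub] by (intro card_Diff_subset) auto
  finally have "card S = l" using card_AC by (simp add: params)
  moreover have "finite S" by (simp add: S_def)
  ultimately obtain \<beta> where \<beta>: "bij_betw \<beta> {..<l} S"
    using ex_bij_betw_nat_finite[of S] by (auto simp: atLeast0LessThan)
  define w where "w y =
    (if y < l then e + 4*n + 1 + y else if y < l + n then nat (A ! \<sigma> (y - l) + int c)
     else if y < N then H ! (y - l - n) else if y < N + l then \<beta> (y - N)
     else if y < N + l + n then g (y - N - l) + 2*c else 2*B + 1 + (y - N - l - n))" for y
  have N: "N = l + n + h" by (simp add: params)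
  have w1: "w i = e + 4*n + 1 + i" "w (N + i) = \<beta> i" if "i < l" for i
    using that by (auto simp: w_def N)
  have w2: "w (l + i) = nat (A ! \<sigma> i + int c)" "w (N + (l + i)) = g i + 2*c" if "i < n" for i
    using that by (auto simp: w_def N)
  have w3: "w (l + n + i) = H ! i" "w (N + (l + n + i)) = 2*B + 1 + i" if "i < h" for i
    using that by (auto simp: w_def N)
  have hit: "x \<in> w ` {..<2*N}" if "w y = x" "y < 2*N" for x y using that by blast
  have sub: "{1..2*N} \<subseteq> w ` {..<2*N}"
  proof
    fix x assume x: "x \<in> {1..2*N}"
    consider "x \<in> S" | "e + 4*n < x" "x \<le> M" | "x \<in> AC" | "x \<in> set H"
      | "x \<in> (\<lambda>t. 2*c + t) ` T" | "2*B < x"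
      using x unfolding S_def set_H by fastforce
    then show "x \<in> w ` {..<2*N}"
    proof cases
      case 1
      then obtain i where "i < l" "\<beta> i = x" using \<beta> by (metis bij_betw_def imageE lessThan_iff)
      then show ?thesis using w1(2) hit[of "N + i"] N by auto
    next
      case 2
      then show ?thesis using w1(1)[of "x - (e + 4*n + 1)"]
        by (intro hit[of "x - (e + 4*n + 1)"]) (auto simp: params)
    next
      case 3
      then obtain j where j: "j < n" "x = nat (A ! j + int c)"
        by (auto simp: AC_def in_set_conv_nth n_def A_def)
      then obtain i where "i < n" "\<sigma> i = j" using \<sigma> by (metis bij_betw_def imageE lessThan_iff)
      then show ?thesis using w2(1)[of i] j N hit[of "l + i"] by auto
    next
      case 4
      then obtain i where "i < h" "H ! i = x" by (auto simp: in_set_conv_nth length_H)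
      then show ?thesis using w3(1)[of i] N hit[of "l + n + i"] by auto
    next
      case 5
      then obtain i where "i < n" "x = 2*c + g i" using g
        by (metis bij_betw_def imageE lessThan_iff)
      then show ?thesis using w2(2)[of i] N by (intro hit[of "N + (l + i)"]) auto
    next
      case 6
      then show ?thesis using w3(2)[of "x - (2*B + 1)"] x
        by (intro hit[of "N + (l + n + (x - (2*B + 1)))"]) (auto simp: params)
    qed
  qed
  \<comment> \<open>Covering \<open>2*N\<close> positions with \<open>2*N\<close> visits forces
    \<open>w\<close> to be injective.\<close>
  have card_w: "card (w ` {..<2*N}) \<le> 2*N" using card_image_le[of "{..<2*N}" w] by simp
  then have img: "{1..2*N} = w ` {..<2*N}" using sub by (intro card_seteq) auto
  then have "card (w ` {..<2*N}) = card {..<2*N}" by (metis card_atLeastAtMost card_lessThan diff_Suc_1)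
  then have "inj_on w {..<2*N}" by (intro eq_card_imp_inj_on) auto
  then have "bij_betw w {..<2*N} {1..2*N}" using img by (simp add: bij_betw_def)
  moreover have "w i \<le> pm_instance D e T ! i \<and> w (N + i) \<le> w i + pm_instance D e T ! i"
    if "i < N" for i
  proof -
    consider "i < l" | j where "j < n" "i = l + j" | j where "j < h" "i = l + n + j"
    proof (cases "i < l + n")
      case True
      then show ?thesis using that(1,2) that(2)[of "i - l"] by (cases "i < l") auto
    next
      case False
      then show ?thesis using that(3)[of "i - (l + n)"] \<open>i < N\<close> N by auto
    qed
    then show ?thesis
    proof cases
      case 1
      then have "\<beta> i \<in> S" using bij_betwE[OF \<beta>] by auto
      then have "\<beta> i \<le> B" by (auto simp: S_def params)
      \<comment> \<open>A low node marked at \<open>e + 4*n + 1\<close> or later reaches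
        \<open>4*e + 13*n + 1\<close>, which is beyond \<open>B\<close>.\<close>
      then show ?thesis using 1 w1[OF 1] nth_pm_instance(1)[OF 1] by (simp add: params)
    next
      case 2
      \<comment> \<open>The shift \<open>c\<close> enters once through the slot and once through the
        node, matching the shift \<open>2*c\<close> of the targets.\<close>
      have "int (w (l + j)) = A ! \<sigma> j + int c"
        using w2(1)[OF 2(1)] A_bounds[OF A\<sigma>[OF 2(1)]] by simp
      then show ?thesis using r[OF 2(1)] w2(2)[OF 2(1)] nth_pm_instance(2)[OF 2(1)]
        unfolding 2(2) by linarith
    next
      case 3
      show ?thesis using w3[OF 3(1)] nth_pm_instance(3)[OF 3(1)] H_ge[OF 3(1)]
        unfolding 3(2) by (simp add: params)
    qed
  qed
  ultimately show ?thesis unfolding two_visits_iff_marked_schedule marked_schedule_def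
      length_pm_instance by blast
qed

text \<open>After the exchange argument, counting forces the rest: high nodes serve the positions
  beyond \<open>2*B\<close>, which leaves the shifted targets to nodes of \<open>D\<close>; low
  nodes are marked in the low interval, which leaves the shifted slots to nodes of
  \<open>D\<close>.\<close>

lemma pos_match_if_two_visits:
  assumes "two_visits (pm_instance D e T)" shows "pos_match D T"
proof -
  define Y where "Y = pm_instance D e T"
  have "set (discretize Y) \<subseteq> {1..2 * int (length Y)}"
    unfolding Y_def set_discretize_pm_instance length_pm_instance
    by (auto simp: params set_H dest!: A_bounds)
  then obtain w where w: "marked_schedule Y w" and img: "int ` w ` {..<N} = set (discretize Y)"
    using marked_schedule_discretize[of Y] assms sorted_pm_instance
    unfolding two_visits_iff_marked_schedule Y_def length_pm_instance by blast
  have bij: "bij_betw w {..<2*N} {1..2*N}"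
    and wle: "\<And>i. i < N \<Longrightarrow> w i \<le> Y ! i \<and> w (N + i) \<le> w i + Y ! i"
    using w unfolding marked_schedule_def Y_def length_pm_instance by auto
  have inj: "inj_on w {..<2*N}" and surj: "w ` {..<2*N} = {1..2*N}" using bij unfolding bij_betw_def by blast+
  have inj': "inj_on (\<lambda>i. w (N + i)) {..<N}"
    by (rule inj_onI) (use inj_onD[OF inj] in fastforce)
  have N: "N = l + n + h" by (simp add: params)
  note Y = nth_pm_instance[folded Y_def]
  have marked: "int (w i) \<in> {int (e + 4*n) + 1..int M} \<union> (\<lambda>a. a + int c) ` set A \<union> int ` set H"
    if "i < N" for i
    using that img unfolding Y_def set_discretize_pm_instance by blast
  have marked_le: "w i \<le> 2*B" if "i < N" for i
  proof -
    have "int (w i) \<le> int M \<or> (\<exists>a\<in>set A. int (w i) = a + int c) \<or> w i \<in> set H"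
      using marked[OF that] by auto
    then show ?thesis using A_bounds set_H by (fastforce simp: params)
  qed
  have unmarked: "\<exists>i<N. x = w (N + i)"
    if "x \<in> {1..2*N}" "int x \<notin> set (discretize Y)" for x
  proof -
    have "x \<in> w ` {..<2*N}" using that(1) by (simp only: surj)
    then obtain y where y: "y < 2*N" "x = w y" by auto
    then have "\<not> y < N" using that(2) unfolding img[symmetric] by blast
    then show ?thesis using y by (intro exI[of _ "y - N"]) auto
  qed
  have Y_low: "w i \<le> B \<and> w (N + i) \<le> 2*B" if "i < l + n" for i
  proof -
    have "Y ! i \<le> B"
    proof (cases "i < l")
      case True
      then show ?thesis using Y(1) by (simp add: params)
    next
      case False
      then have "i - l < n" using that by simp
      moreover then have "D ! (i - l) \<le> e" using D_bounds by (simp add: n_def)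
      ultimately show ?thesis using Y(2)[of "i - l"] False by (simp add: params)
    qed
    then show ?thesis using wle[of i] that N by auto
  qed
  text \<open>The topmost positions can only be served by the nodes of \<open>H\<close> and exhaust them.\<close>
  define I where "I = {i. i < N \<and> 2*B < w (N + i)}"
  have "I \<subseteq> {l + n..<N}" using Y_low by (auto simp: I_def) (meson leD leI)
  moreover have "card I = h"
  proof -
    have "(\<lambda>i. w (N + i)) ` I = {2*B + 1..2*N}"
    proof (intro equalityI subsetI)
      fix x assume "x \<in> (\<lambda>i. w (N + i)) ` I"
      then show "x \<in> {2*B + 1..2*N}" using bij_betwE[OF bij] by (auto simp: I_def)
    next
      fix x assume x: "x \<in> {2*B + 1..2*N}"
      then have "int x \<notin> set (discretize Y)"
        unfolding img[symmetric] using marked_le by (auto dest!: marked_le)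
      moreover have "x \<in> {1..2*N}" using x by simp
      ultimately obtain i where "i < N" "x = w (N + i)" using unmarked by blast
      then show "x \<in> (\<lambda>i. w (N + i)) ` I" using x by (auto simp: I_def)
    qed
    moreover have "inj_on (\<lambda>i. w (N + i)) I"
      using inj' by (rule inj_on_subset) (auto simp: I_def)
    ultimately have "card I = card {2*B + 1..2*N}" by (metis card_image)
    then show ?thesis by (simp add: params)
  qed
  ultimately have I: "I = {l + n..<N}" by (intro card_subset_eq) (auto simp: N)
  have T_real: "\<exists>i<n. w (N + (l + i)) = 2*c + t" if t: "t \<in> T" for t
  proof -
    have tb: "1 \<le> t" "t \<le> 2 * (e + n)" using t T_sub by auto
    have "2*c + t \<notin> set H" using t by (simp add: set_H)
    then have "int (2*c + t) \<notin> int ` set H" by (simp only: inj_image_mem_iff[OF inj_of_nat] not_False_eq_True)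
    moreover have "int (2*c + t) \<notin> (\<lambda>a. a + int c) ` set A"
      using tb by (auto simp: params dest!: A_bounds)
    moreover have "int M < int (2*c + t)" using tb by (simp add: params)
    ultimately have "int (2*c + t) \<notin> set (discretize Y)"
      unfolding Y_def set_discretize_pm_instance by (metis UnE atLeastAtMost_iff not_le)
    moreover have "2*c + t \<in> {1..2*N}" using tb by (auto simp: params)
    ultimately obtain i where i: "i < N" "2*c + t = w (N + i)" using unmarked by blast
    \<comment> \<open>Position \<open>2*c + t\<close> is at most \<open>2*B\<close>, hence not
      served by a high node; a low node reaches at most \<open>2*M\<close>, which is less. Only a
      node of \<open>D\<close> remains.\<close>
    have "i \<notin> I" using i tb by (auto simp: I_def params)
    then have "i < l + n" using i I by auto
    moreover have "\<not> i < l" using wle[OF i(1)] Y(1)[of i] i(2) tb(1) by (auto simp: params)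
    ultimately show ?thesis using i by (intro exI[of _ "i - l"]) auto
  qed
  define g where "g i = w (N + (l + i)) - 2*c" for i
  have "(\<lambda>t. 2*c + t) ` T \<subseteq> (\<lambda>i. w (N + (l + i))) ` {..<n}"
  proof
    fix x assume "x \<in> (\<lambda>t. 2*c + t) ` T"
    then obtain t where "t \<in> T" "x = 2*c + t" by auto
    with T_real[of t] obtain i where "i < n" "x = w (N + (l + i))" by auto
    then show "x \<in> (\<lambda>i. w (N + (l + i))) ` {..<n}" by blast
  qed
  \<comment> \<open>The \<open>n\<close> nodes of \<open>D\<close> have only \<open>n\<close>
    unmarked visits, so these are spent on the shifted targets alone.\<close>
  moreover have "card ((\<lambda>i. w (N + (l + i))) ` {..<n}) \<le> card ((\<lambda>t. 2*c + t) ` T)"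
    using card_image_le[of "{..<n}"] card_T by (auto simp: card_image)
  ultimately have eq: "(\<lambda>t. 2*c + t) ` T = (\<lambda>i. w (N + (l + i))) ` {..<n}"
    by (intro card_seteq) auto
  have g_eq: "w (N + (l + i)) = 2*c + g i" "g i \<in> T" if "i < n" for i
  proof -
    have "w (N + (l + i)) \<in> (\<lambda>t. 2*c + t) ` T" unfolding eq using that by blast
    then obtain t where "t \<in> T" "w (N + (l + i)) = 2*c + t" by auto
    then show "w (N + (l + i)) = 2*c + g i" "g i \<in> T" by (auto simp: g_def)
  qed
  have "inj_on g {..<n}"
  proof (rule inj_onI)
    fix i j assume "i \<in> {..<n}" "j \<in> {..<n}" "g i = g j"
    then show "i = j" using g_eq inj_onD[OF inj', of "l + i" "l + j"] N by auto
  qed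
  moreover have "g ` {..<n} = T"
  proof (intro equalityI subsetI)
    fix t assume "t \<in> T"
    with T_real[of t] obtain i where "i < n" "t = g i" by (auto simp: g_def)
    then show "t \<in> g ` {..<n}" by blast
  qed (use g_eq(2) in auto)
  ultimately have g: "bij_betw g {..<n} T" by (simp add: bij_betw_def)
  \<comment> \<open>The only marked positions up to \<open>M\<close> are these \<open>l\<close>
    ones, so the \<open>l\<close> low nodes use them all up.\<close>
  have low: "w ` {..<l} = {e + 4*n + 1..M}"
  proof (rule card_subset_eq)
    show "w ` {..<l} \<subseteq> {e + 4*n + 1..M}"
    proof
      fix x assume "x \<in> w ` {..<l}"
      then obtain i where i: "i < l" "x = w i" by auto
      then have "w i \<le> M" using wle[of i] Y(1)[of i] N by auto
      then show "x \<in> {e + 4*n + 1..M}"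
        using marked[of i] i N unfolding set_H by (auto simp: params dest!: A_bounds)
    qed
    show "card (w ` {..<l}) = card {e + 4*n + 1..M}"
      using inj_on_subset[OF inj, of "{..<l}"] N by (simp add: card_image) (simp add: params)
  qed auto
  have "\<exists>j<n. A ! j = int (w (l + i)) - int c" if i: "i < n" for i
  proof -
    have "w (l + i) \<le> B" using Y_low i by auto
    moreover have "w (l + i) \<notin> w ` {..<l}" using inj i N by (auto dest!: inj_onD)
    ultimately have "int (w (l + i)) \<in> (\<lambda>a. a + int c) ` set A"
      using marked[of "l + i"] i N unfolding low set_H by auto
    then show ?thesis by (force simp: in_set_conv_nth n_def A_def)
  qed
  then obtain \<sigma> where \<sigma>: "\<And>i. i < n \<Longrightarrow> \<sigma> i < n \<and> A ! \<sigma> i = int (w (l + i)) - int c"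
    by metis
  have "inj_on \<sigma> {..<n}"
  proof (rule inj_onI)
    fix i j assume ij: "i \<in> {..<n}" "j \<in> {..<n}" "\<sigma> i = \<sigma> j"
    then have "w (l + i) = w (l + j)" using \<sigma>[of i] \<sigma>[of j] by auto
    then show "i = j" using inj_onD[OF inj, of "l + i" "l + j"] ij N by auto
  qed
  then have \<sigma>_bij: "bij_betw \<sigma> {..<n} {..<n}"
    using \<sigma> endo_inj_surj[of "{..<n}" \<sigma>] by (auto simp: bij_betw_def)
  have "A ! \<sigma> i \<le> int (D ! i) \<and> int (g i) \<le> int (D ! i) + A ! \<sigma> i" if i: "i < n" for i
    using wle[of "l + i"] Y(2)[OF i] \<sigma>[OF i] g_eq(1)[OF i] i N by auto
  then show ?thesis unfolding pos_match_def Let_def n_def[symmetric] A_def[symmetric] using \<sigma>_bij g by blast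
qed

end

lemma pm_instance:
  assumes "sorted D" "\<forall>d\<in>set D. 0 < d \<and> d \<le> e" "T \<subseteq> {1..2 * (e + length D)}" "card T = length D"
  shows "two_visits (pm_instance D e T) \<longleftrightarrow> pos_match D T"
    and "length (pm_instance D e T) = 6*e + 16 * length D"
    and "sorted (pm_instance D e T)"
    and "\<forall>y\<in>set (pm_instance D e T). 0 < y"
proof -
  note prems = refl assms refl refl refl refl refl refl refl refl
  show "two_visits (pm_instance D e T) \<longleftrightarrow> pos_match D T"
    using two_visits_if_pos_match[OF prems] pos_match_if_two_visits[OF prems] by blast
  show "length (pm_instance D e T) = 6*e + 16 * length D" by (rule length_pm_instance[OF prems])
  show "sorted (pm_instance D e T)" by (rule sorted_pm_instance[OF prems])
  show "\<forall>y\<in>set (pm_instance D e T). 0 < y" by (rule pm_instance_pos[OF prems])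
qed

subsection \<open>Structured programs for the machine\<close>

datatype com = Block "instr list" | Seq com com | If nat com com | While nat com

fun csize :: "com \<Rightarrow> nat" where
  "csize (Block is) = length is"
| "csize (Seq a b) = csize a + csize b"
| "csize (If r a b) = csize a + csize b + 2"
| "csize (While r a) = csize a + 2"

text \<open>The machine has no unconditional jump; register 0 is kept at 0 and \<open>RJz 0\<close> serves as one.\<close>
fun comp :: "nat \<Rightarrow> com \<Rightarrow> instr list" where
  "comp off (Block is) = is"
| "comp off (Seq a b) = comp off a @ comp (off + csize a) b"
| "comp off (If r a b) = RJz r (off + csize a + 2) # comp (off + 1) a @
     RJz 0 (off + csize a + 2 + csize b) # comp (off + csize a + 2) b"
| "comp off (While r a) = RJz r (off + csize a + 2) # comp (off + 1) a @ [RJz 0 off]"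

lemma length_comp [simp]: "length (comp off c) = csize c"
  by (induction c arbitrary: off) auto

type_synonym state = "(nat \<Rightarrow> nat) \<times> (nat \<Rightarrow> nat)"

text \<open>Writes to register 0 are excluded so that \<open>RJz 0\<close> always jumps.\<close>

fun straight :: "instr \<Rightarrow> bool" where
  "straight (RConst r k) \<longleftrightarrow> r \<noteq> 0"
| "straight (RAdd r s t) \<longleftrightarrow> r \<noteq> 0"
| "straight (RSub r s t) \<longleftrightarrow> r \<noteq> 0"
| "straight (RLoad r s) \<longleftrightarrow> r \<noteq> 0"
| "straight (RStore r s) \<longleftrightarrow> True"
| "straight (RJz r l) \<longleftrightarrow> False"
| "straight RHalt \<longleftrightarrow> False"

fun run1 :: "instr \<Rightarrow> state \<Rightarrow> state" where
  "run1 (RConst r k) (reg, mem) = (reg(r := k), mem)"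
| "run1 (RAdd r s t) (reg, mem) = (reg(r := reg s + reg t), mem)"
| "run1 (RSub r s t) (reg, mem) = (reg(r := reg s - reg t), mem)"
| "run1 (RLoad r s) (reg, mem) = (reg(r := mem (reg s)), mem)"
| "run1 (RStore r s) (reg, mem) = (reg, mem(reg s := reg r))"
| "run1 _ s = s"

definition placed :: "instr list \<Rightarrow> nat \<Rightarrow> instr list \<Rightarrow> bool" where
  "placed prog off code \<longleftrightarrow>
     (\<forall>i<length code. off + i < length prog \<and> prog ! (off + i) = code ! i)"

lemma placed_Cons:
  "placed prog off (x # xs) \<longleftrightarrow> off < length prog \<and> prog ! off = x \<and> placed prog (Suc off) xs"
  unfolding placed_def by (auto simp: All_less_Suc2)

lemma placed_append:
  "placed prog off (xs @ ys) \<longleftrightarrow> placed prog off xs \<and> placed prog (off + length xs) ys"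
proof (induction xs arbitrary: off)
  case Nil
  then show ?case by (simp add: placed_def)
qed (auto simp: placed_Cons)

lemma exec_0 [simp]: "exec prog 0 c = c" by (simp add: exec_def)

lemma exec_Suc: "exec prog (Suc t) c = exec prog t (step prog c)"
  by (simp add: exec_def funpow_swap1)

lemma exec_add: "exec prog (t + t') c = exec prog t' (exec prog t c)"
  by (simp add: exec_def funpow_add add.commute[of t])

lemma step_straight:
  "off < length prog \<Longrightarrow> straight (prog ! off) \<Longrightarrow>
    step prog (off, s) = (Suc off, run1 (prog ! off) s)"
  by (cases s; cases "prog ! off") (auto simp: step_def halted_def)

lemma step_RJz:
  "off < length prog \<Longrightarrow> prog ! off = RJz r l \<Longrightarrow>
    step prog (off, s) = (if fst s r = 0 then l else Suc off, s)"
  by (cases s) (auto simp: step_def halted_def)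

text \<open>Total correctness with a step bound. Control must leave just behind the code; since
  jumps are absolute, quantifying over the surrounding program and the offset is what makes triples
  compose.\<close>

definition triple :: "(state \<Rightarrow> bool) \<Rightarrow> com \<Rightarrow> nat \<Rightarrow> (state \<Rightarrow> bool) \<Rightarrow> bool" where
  "triple P c T Q \<longleftrightarrow> (\<forall>prog off s. placed prog off (comp off c) \<longrightarrow> P s \<longrightarrow>
     (\<exists>t s'. t \<le> T \<and> exec prog t (off, s) = (off + csize c, s') \<and> Q s'))"

lemma tripleI:
  "(\<And>prog off s. placed prog off (comp off c) \<Longrightarrow> P s \<Longrightarrow>
     \<exists>t s'. t \<le> T \<and> exec prog t (off, s) = (off + csize c, s') \<and> Q s') \<Longrightarrow> triple P c T Q"
  unfolding triple_def by blast

lemma tripleE: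
  assumes "triple P c T Q" "placed prog off (comp off c)" "P s"
  obtains t s' where "t \<le> T" "exec prog t (off, s) = (off + csize c, s')" "Q s'"
  using assms unfolding triple_def by blast

lemma triple_conseq:
  "triple P c T Q \<Longrightarrow> (\<And>s. P' s \<Longrightarrow> P s) \<Longrightarrow> T \<le> T' \<Longrightarrow> (\<And>s. Q s \<Longrightarrow> Q' s) \<Longrightarrow> triple P' c T' Q'"
  unfolding triple_def by (meson order_trans)

lemma triple_ex: "(\<And>x. triple (P x) c T Q) \<Longrightarrow> triple (\<lambda>s. \<exists>x. P x s) c T Q"
  unfolding triple_def by blast

lemma triple_pure: "(A \<Longrightarrow> triple P c T Q) \<Longrightarrow> triple (\<lambda>s. A \<and> P s) c T Q"
  unfolding triple_def by blast

text \<open>Loop-free code as a function on states, so that simplification can execute loop bodies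
  symbolically.\<close>

fun lrun :: "com \<Rightarrow> state \<Rightarrow> state" where
  "lrun (Block is) s = fold run1 is s"
| "lrun (Seq a b) s = lrun b (lrun a s)"
| "lrun (If r a b) s = (if fst s r = 0 then lrun b s else lrun a s)"
| "lrun (While r a) s = s"

fun loopfree :: "com \<Rightarrow> bool" where
  "loopfree (Block is) = list_all straight is"
| "loopfree (Seq a b) = (loopfree a \<and> loopfree b)"
| "loopfree (If r a b) = (loopfree a \<and> loopfree b)"
| "loopfree (While r a) = False"

lemma exec_block:
  "placed prog off is \<Longrightarrow> list_all straight is \<Longrightarrow>
    exec prog (length is) (off, s) = (off + length is, fold run1 is s)"
  by (induction "is" arbitrary: off s) (auto simp: placed_Cons exec_Suc step_straight)

lemma fold_run1_reg0: "list_all straight is \<Longrightarrow> fst (fold run1 is s) 0 = fst s 0"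
proof (induction "is" arbitrary: s)
  case (Cons i "is")
  have "fst (run1 i s) 0 = fst s 0" using Cons.prems by (cases i; cases s) auto
  then show ?case using Cons by simp
qed auto

lemma lrun_reg0: "loopfree c \<Longrightarrow> fst (lrun c s) 0 = fst s 0"
  by (induction c arbitrary: s) (auto simp: fold_run1_reg0)

text \<open>Without loops no instruction runs twice, so the code size bounds the time.\<close>

lemma exec_loopfree:
  "loopfree c \<Longrightarrow> placed prog off (comp off c) \<Longrightarrow> fst s 0 = 0 \<Longrightarrow>
    \<exists>t\<le>csize c. exec prog t (off, s) = (off + csize c, lrun c s)"
proof (induction c arbitrary: off s)
  case (Block "is")
  then show ?case by (auto simp: exec_block intro!: exI[of _ "length is"])
next
  case (Seq a b)
  then have pl: "placed prog off (comp off a)" "placed prog (off + csize a) (comp (off + csize a) b)"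
    by (auto simp: placed_append)
  obtain t1 where 1: "t1 \<le> csize a" "exec prog t1 (off, s) = (off + csize a, lrun a s)"
    using Seq.IH(1)[OF _ pl(1) Seq.prems(3)] Seq.prems(1) unfolding loopfree.simps by blast
  obtain t2 where 2: "t2 \<le> csize b"
    "exec prog t2 (off + csize a, lrun a s) = (off + csize a + csize b, lrun b (lrun a s))"
    using Seq.IH(2)[OF _ pl(2), of "lrun a s"] Seq.prems(1,3) lrun_reg0[of a s]
    unfolding loopfree.simps by metis
  show ?case using 1 2 by (intro exI[of _ "t1 + t2"]) (simp add: exec_add add.assoc)
next
  case (If r a b)
  then have pa: "placed prog (Suc off) (comp (Suc off) a)"
    and pb: "placed prog (off + csize a + 2) (comp (off + csize a + 2) b)"
    and o: "off < length prog" "prog ! off = RJz r (off + csize a + 2)"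
    and e: "Suc off + csize a < length prog"
       "prog ! (Suc off + csize a) = RJz 0 (off + csize a + 2 + csize b)"
    by (auto simp: placed_append placed_Cons)
  show ?case
  proof (cases "fst s r = 0")
    case True
    obtain t where "t \<le> csize b"
      "exec prog t (off + csize a + 2, s) = (off + csize a + 2 + csize b, lrun b s)"
      using If.IH(2)[OF _ pb If.prems(3)] If.prems(1) unfolding loopfree.simps by blast
    then show ?thesis using True step_RJz[OF o, of s]
      by (intro exI[of _ "Suc t"]) (simp add: exec_Suc)
  next
    case False
    obtain t where t: "t \<le> csize a" "exec prog t (Suc off, s) = (Suc off + csize a, lrun a s)"
      using If.IH(1)[OF _ pa If.prems(3)] If.prems(1) unfolding loopfree.simps by blast
    have "fst (lrun a s) 0 = 0" using If.prems lrun_reg0 by auto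
    then have "exec prog (Suc (t + 1)) (off, s) = (off + csize a + 2 + csize b, lrun a s)"
      using t False step_RJz[OF o, of s] step_RJz[OF e, of "lrun a s"]
      unfolding exec_Suc exec_add by (simp add: exec_Suc)
    then show ?thesis using t False by (intro exI[of _ "Suc (t + 1)"]) simp
  qed
qed auto

lemma triple_loopfree:
  assumes "loopfree c" "\<And>reg mem. P (reg, mem) \<Longrightarrow> reg 0 = 0 \<and> Q (lrun c (reg, mem))"
  shows "triple P c (csize c) Q"
proof (rule tripleI)
  fix prog off s assume pl: "placed prog off (comp off c)" and "P s"
  then have "fst s 0 = 0" "Q (lrun c s)" using assms(2)[of "fst s" "snd s"] by simp_all
  then show "\<exists>t s'. t \<le> csize c \<and> exec prog t (off, s) = (off + csize c, s') \<and> Q s'"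
    using exec_loopfree[OF assms(1) pl, of s] by blast
qed

lemma triple_Seq:
  assumes "triple P a T1 R" "triple R b T2 Q"
  shows "triple P (Seq a b) (T1 + T2) Q"
proof (rule tripleI)
  fix prog off s assume pl: "placed prog off (comp off (Seq a b))" and "P s"
  then have pl': "placed prog off (comp off a)" "placed prog (off + csize a) (comp (off + csize a) b)"
    by (auto simp: placed_append)
  obtain t1 s1 where 1: "t1 \<le> T1" "exec prog t1 (off, s) = (off + csize a, s1)" "R s1"
    using tripleE[OF assms(1) pl'(1) \<open>P s\<close>] .
  obtain t2 s2 where 2: "t2 \<le> T2"
    "exec prog t2 (off + csize a, s1) = (off + csize a + csize b, s2)" "Q s2"
    using tripleE[OF assms(2) pl'(2) 1(3)] .
  show "\<exists>t s'. t \<le> T1 + T2 \<and> exec prog t (off, s) = (off + csize (Seq a b), s') \<and> Q s'"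
    using 1 2 by (intro exI[of _ "t1 + t2"] exI[of _ s2]) (simp add: exec_add add.assoc)
qed

text \<open>\<open>I\<close> is indexed by the number of finished rounds while register
  \<open>r\<close> counts down. A round costs the body plus two jumps, and the final test one more
  step.\<close>

lemma triple_While:
  assumes body: "\<And>k. k < N \<Longrightarrow> triple (I k) a T (I (Suc k))"
    and reg: "\<And>k s. I k s \<Longrightarrow> fst s 0 = 0 \<and> fst s r = N - k"
  shows "triple (I 0) (While r a) (N * (T + 2) + 1) (I N)"
proof (rule tripleI)
  fix prog off s assume pl: "placed prog off (comp off (While r a))" and "I 0 s"
  have pa: "placed prog (Suc off) (comp (Suc off) a)"
    and o: "off < length prog" "prog ! off = RJz r (off + csize a + 2)"
    and e: "Suc off + csize a < length prog" "prog ! (Suc off + csize a) = RJz 0 off"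
    using pl by (auto simp: placed_append placed_Cons)
  have "\<exists>t s'. t \<le> (N - k) * (T + 2) + 1 \<and> exec prog t (off, s) = (off + csize a + 2, s') \<and> I N s'"
    if "I k s" "k \<le> N" for k s
    using that
  proof (induction "N - k" arbitrary: k s)
    case 0
    then have "k = N" by simp
    then show ?case using 0 reg[of k s] step_RJz[OF o, of s]
      by (intro exI[of _ 1] exI[of _ s]) (simp add: exec_Suc)
  next
    case (Suc d)
    then have k: "k < N" by simp
    obtain t s1 where t: "t \<le> T" "exec prog t (Suc off, s) = (Suc off + csize a, s1)" "I (Suc k) s1"
      using tripleE[OF body[OF k] pa] Suc.prems by blast
    have 1: "exec prog (Suc (t + 1)) (off, s) = (off, s1)"
      using t reg[OF Suc.prems(1)] reg[OF t(3)] k step_RJz[OF o, of s] step_RJz[OF e, of s1]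
      unfolding exec_Suc exec_add by (simp add: exec_Suc)
    obtain t' s' where 2: "t' \<le> (N - Suc k) * (T + 2) + 1"
      "exec prog t' (off, s1) = (off + csize a + 2, s')" "I N s'"
      using Suc.hyps(1)[of "Suc k" s1] Suc.hyps(2) t(3) k by (metis Suc_diff_Suc Suc_inject Suc_leI)
    have "N - k = Suc (N - Suc k)" using k by simp
    then have "Suc (t + 1) + t' \<le> (N - k) * (T + 2) + 1" using t(1) 2(1) by simp
    moreover have "exec prog (Suc (t + 1) + t') (off, s) = (off + csize a + 2, s')"
      by (simp only: exec_add[of prog "Suc (t + 1)"] 1 2)
    ultimately show ?case using 2(3) by blast
  qed
  from this[OF \<open>I 0 s\<close>] show "\<exists>t s'. t \<le> N * (T + 2) + 1 \<and>
      exec prog t (off, s) = (off + csize (While r a), s') \<and> I N s'" by simp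
qed

subsection \<open>The reduction program\<close>

text \<open>Memory cell 0 of the input holds the length of the encoding and cell 1 holds \<open>n\<close>.\<close>
definition mem_lists :: "(nat \<Rightarrow> nat) \<Rightarrow> nat list \<Rightarrow> nat list \<Rightarrow> bool" where
  "mem_lists mem D ts \<longleftrightarrow>
     (\<forall>k<length D. mem (Suc (Suc k)) = D ! k \<and> mem (length D + Suc (Suc k)) = ts ! k) \<and>
     (\<forall>a>Suc (2 * length D). mem a = 0)"

text \<open>Registers 1 to 5 hold 1, \<open>n\<close>, the rounds left, the previous entry
  \<open>hi\<close> and the address of the current entry; adding register 0 copies. Register 6
  receives the excess \<open>g\<close>, register 8 the number of inner rounds: \<open>n\<close>, or
  0 if \<open>g\<close> is 0.\<close>

definition shrink_setup :: com where
  "shrink_setup = Seq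
     (Block [RLoad 7 5, RAdd 6 4 2, RSub 6 7 6, RConst 8 0, RAdd 9 1 0, RAdd 10 4 4,
             RAdd 11 6 6, RAdd 12 11 2])
     (If 6 (Block [RAdd 8 2 0]) (Block []))"

text \<open>Truncated subtraction serves as comparison: the result is nonzero exactly if the first
  operand is larger. Register 9 holds the index plus one, which is also the offset of a target
  placed in the gap.\<close>

definition shrink_body :: com where
  "shrink_body =
    Seq (Block [RAdd 15 9 1, RLoad 13 15, RSub 14 13 4])
   (Seq (If 14 (Block [RSub 13 13 6, RStore 13 15]) (Block []))
   (Seq (Block [RAdd 15 15 2, RLoad 13 15, RSub 14 13 10])
   (Seq (If 14
           (Seq (Block [RSub 16 14 12]) (If 16 (Block [RSub 13 13 11]) (Block [RAdd 13 10 9])))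
           (Block []))
        (Block [RStore 13 15, RAdd 9 9 1, RSub 8 8 1]))))"

text \<open>The current entry is loaded again after the sweep, which may have shrunk it; it is the
  next \<open>hi\<close>.\<close>

definition compress_body :: com where
  "compress_body = Seq shrink_setup
     (Seq (While 8 shrink_body) (Block [RLoad 4 5, RAdd 5 5 1, RSub 3 3 1]))"

definition compress_frame :: "nat \<Rightarrow> nat \<Rightarrow> nat \<Rightarrow> (nat \<Rightarrow> nat) \<Rightarrow> bool" where
  "compress_frame n i hi reg \<longleftrightarrow>
     reg 0 = 0 \<and> reg 1 = 1 \<and> reg 2 = n \<and> reg 3 = n - i \<and> reg 4 = hi \<and> reg 5 = Suc (Suc i)"

definition shrink_inv :: "nat list \<Rightarrow> nat list \<Rightarrow> nat \<Rightarrow> nat \<Rightarrow> nat \<Rightarrow> nat \<Rightarrow> nat \<Rightarrow> state \<Rightarrow> bool" where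
  "shrink_inv D ts i hi g N k s \<longleftrightarrow> (case s of (reg, mem) \<Rightarrow> let n = length D in
     compress_frame n i hi reg \<and> reg 6 = g \<and> reg 8 = N - k \<and> reg 9 = Suc k \<and>
     reg 10 = 2 * hi \<and> reg 11 = 2 * g \<and> reg 12 = 2 * g + n \<and>
     (\<forall>j<n. mem (Suc (Suc j)) = (if j < k then shrink_dist hi g (D ! j) else D ! j) \<and>
        mem (n + Suc (Suc j)) = (if j < k then shrink_target n hi g j (ts ! j) else ts ! j)) \<and>
     (\<forall>a>Suc (2*n). mem a = 0))"

lemma shrink_body_correct:
  assumes "k < N" "N \<le> length D"
  shows "triple (shrink_inv D ts i hi g N k) shrink_body (csize shrink_body)
    (shrink_inv D ts i hi g N (Suc k))"
proof (rule triple_loopfree)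
  fix reg mem assume inv: "shrink_inv D ts i hi g N k (reg, mem)"
  define n where "n = length D"
  define mem' where "mem' = mem(Suc (Suc k) := shrink_dist hi g (D ! k),
    Suc (Suc (n + k)) := shrink_target n hi g k (ts ! k))"
  define reg' where "reg' = fst (lrun shrink_body (reg, mem))"
  have k: "k < n" using assms by (simp add: n_def)
  have reg: "reg 0 = 0" "reg 1 = 1" "reg 2 = n" "reg 4 = hi" "reg 6 = g" "reg 8 = N - k"
      "reg 9 = Suc k" "reg 10 = 2 * hi" "reg 11 = 2 * g" "reg 12 = 2 * g + n"
      "reg 3 = n - i" "reg 5 = Suc (Suc i)"
    and mem: "mem (Suc (Suc k)) = D ! k" "mem (Suc (Suc (n + k))) = ts ! k"
    using inv k by (auto simp: shrink_inv_def compress_frame_def n_def Let_def)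
  have 1: "lrun shrink_body (reg, mem) = (reg', mem')"
    using reg mem k unfolding reg'_def mem'_def shrink_body_def
    by (cases "D ! k \<le> hi"; cases "ts ! k \<le> 2 * hi"; cases "ts ! k \<le> 2 * hi + (2 * g + n)")
       (simp_all add: shrink_dist_def shrink_target_def fun_upd_idem add.commute[of k])
  have 2: "compress_frame n i hi reg' \<and> reg' 6 = g \<and> reg' 8 = N - Suc k \<and> reg' 9 = Suc (Suc k) \<and>
     reg' 10 = 2 * hi \<and> reg' 11 = 2 * g \<and> reg' 12 = 2 * g + n"
    using reg mem k unfolding reg'_def shrink_body_def compress_frame_def
    by (cases "D ! k \<le> hi"; cases "ts ! k \<le> 2 * hi"; cases "ts ! k \<le> 2 * hi + (2 * g + n)")
       (simp_all add: add.commute[of k])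
  show "reg 0 = 0 \<and> shrink_inv D ts i hi g N (Suc k) (lrun shrink_body (reg, mem))"
    using inv 2 reg(1) k unfolding shrink_inv_def 1 mem'_def
    by (auto simp: Let_def n_def less_Suc_eq)
qed (simp add: shrink_body_def)

text \<open>The last conjunct is the size bound; at \<open>i = length D0\<close> it bounds the
  largest entry by the square of the length.\<close>

definition reduced :: "nat list \<Rightarrow> nat list \<Rightarrow> nat \<Rightarrow> nat list \<Rightarrow> nat list \<Rightarrow> bool" where
  "reduced D0 ts0 i D ts \<longleftrightarrow>
     length D = length D0 \<and> length ts = length D0 \<and> sorted D \<and> (\<forall>d\<in>set D. 0 < d) \<and>
     distinct ts \<and> (\<forall>t\<in>set ts. 0 < t) \<and> (pos_match D (set ts) \<longleftrightarrow> pos_match D0 (set ts0)) \<and>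
     (0 < i \<longrightarrow> D ! (i - 1) \<le> i * length D0)"

text \<open>The value 0 at the start lets the space below the first entry be compressed like any
  other gap.\<close>

definition prev :: "nat list \<Rightarrow> nat \<Rightarrow> nat" where
  "prev D i = (if i = 0 then 0 else D ! (i - 1))"

text \<open>If \<open>g = 0\<close>, the current entry is at most \<open>hi + n\<close>. Otherwise
  sortedness yields the gap required by \<open>pos_match_shrink\<close>, and the current entry
  becomes \<open>hi + n\<close>. Either way the bound grows by \<open>n\<close>.\<close>

lemma reduced_step:
  assumes red: "reduced D0 ts0 i D ts" and i: "i < length D0"
    and g: "g = D ! i - (prev D i + length D0)"
  shows "reduced D0 ts0 (Suc i) (if g = 0 then D else map (shrink_dist (prev D i) g) D)
    (if g = 0 then ts else shrink_targets (prev D i) g ts)"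
proof -
  define n hi where "n = length D0" and "hi = prev D i"
  have D: "length D = n" "length ts = n" "sorted D" "\<forall>d\<in>set D. 0 < d" "distinct ts" "\<forall>t\<in>set ts. 0 < t"
    and pm: "pos_match D (set ts) \<longleftrightarrow> pos_match D0 (set ts0)"
    and hi: "hi \<le> i * n"
    using red unfolding reduced_def n_def hi_def prev_def by auto
  have i: "i < n" using i by (simp add: n_def)
  have next_le: "hi + n \<le> Suc i * n" using hi by simp
  show ?thesis
  proof (cases "g = 0")
    case True
    then have "D ! i \<le> hi + n" using g by (simp add: n_def hi_def)
    then have "D ! i \<le> Suc i * n" using next_le by linarith
    then show ?thesis using True D pm unfolding reduced_def n_def by auto
  next
    case False
    then have Di: "D ! i = hi + g + n" using g by (simp add: n_def hi_def)
    have gap: "\<forall>d\<in>set D. d \<le> hi \<or> hi + g + n \<le> d"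
    proof
      fix d assume "d \<in> set D"
      then obtain j where j: "j < n" "d = D ! j" using D(1) by (auto simp: in_set_conv_nth)
      show "d \<le> hi \<or> hi + g + n \<le> d"
      proof (cases "j < i")
        case True
        then have "D ! j \<le> D ! (i - 1)" using D(1,3) i by (intro sorted_nth_mono) auto
        then show ?thesis using True j by (simp add: hi_def prev_def)
      next
        case False
        then have "D ! i \<le> D ! j" using D(1,3) j by (intro sorted_nth_mono) auto
        then show ?thesis using Di j by simp
      qed
    qed
    define D' ts' where "D' = map (shrink_dist hi g) D" and "ts' = shrink_targets hi g ts"
    have "sorted D'" unfolding D'_def using D(3) gap by (rule sorted_shrink_dist)
    moreover have "\<forall>d\<in>set D'. 0 < d"
      using D(4) gap i by (fastforce simp: D'_def shrink_dist_def)
    moreover have "pos_match D' (set ts') \<longleftrightarrow> pos_match D (set ts)"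
      unfolding D'_def ts'_def using D gap by (intro pos_match_shrink) auto
    moreover have "D' ! i \<le> Suc i * n"
      using next_le i D(1) Di by (simp add: D'_def shrink_dist_def)
    ultimately show ?thesis using False D pm unfolding reduced_def
      by (simp add: D'_def[symmetric] ts'_def[symmetric] hi_def[symmetric] n_def[symmetric])
         (simp add: D'_def ts'_def distinct_shrink_targets shrink_targets_pos)
  qed
qed

definition compress_inv :: "nat list \<Rightarrow> nat list \<Rightarrow> nat \<Rightarrow> state \<Rightarrow> bool" where
  "compress_inv D0 ts0 i s \<longleftrightarrow> (\<exists>D ts. reduced D0 ts0 i D ts \<and>
     compress_frame (length D0) i (prev D i) (fst s) \<and> mem_lists (snd s) D ts)"

definition compress_time :: "nat \<Rightarrow> nat" where
  "compress_time n = csize shrink_setup + ((n * (csize shrink_body + 2) + 1) + 3)"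

lemma compress_body_correct:
  assumes i: "i < length D0"
  shows "triple (compress_inv D0 ts0 i) compress_body (compress_time (length D0))
    (compress_inv D0 ts0 (Suc i))"
  unfolding compress_inv_def[of D0 ts0 i, abs_def]
proof (intro triple_ex triple_pure)
  fix D ts assume red: "reduced D0 ts0 i D ts"
  define n hi where "n = length D0" and "hi = prev D i"
  define g where "g = D ! i - (hi + n)"
  define N where "N = (if g = 0 then 0 else n)"
  define D' where "D' = (if g = 0 then D else map (shrink_dist hi g) D)"
  define ts' where "ts' = (if g = 0 then ts else shrink_targets hi g ts)"
  have n: "length D = n" "length ts = n" "i < n" using red i by (auto simp: reduced_def n_def)
  have 1: "triple (\<lambda>s. compress_frame n i hi (fst s) \<and> mem_lists (snd s) D ts)
      shrink_setup (csize shrink_setup) (shrink_inv D ts i hi g N 0)"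
  proof (rule triple_loopfree)
    fix reg mem
    assume "compress_frame n i hi (fst (reg, mem)) \<and> mem_lists (snd (reg, mem)) D ts"
    then show "reg 0 = 0 \<and> shrink_inv D ts i hi g N 0 (lrun shrink_setup (reg, mem))"
      using n unfolding shrink_inv_def compress_frame_def shrink_setup_def mem_lists_def
      by (auto simp: Let_def N_def g_def)
  qed (simp add: shrink_setup_def)
  have 2: "triple (shrink_inv D ts i hi g N 0) (While 8 shrink_body)
      (N * (csize shrink_body + 2) + 1) (shrink_inv D ts i hi g N N)"
  proof (rule triple_While)
    show "triple (shrink_inv D ts i hi g N k) shrink_body (csize shrink_body)
      (shrink_inv D ts i hi g N (Suc k))" if "k < N" for k
      using that n by (intro shrink_body_correct) (auto simp: N_def split: if_splits)
  qed (auto simp: shrink_inv_def compress_frame_def Let_def)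
  have 3: "triple (shrink_inv D ts i hi g N N) (Block [RLoad 4 5, RAdd 5 5 1, RSub 3 3 1])
      (csize (Block [RLoad 4 5, RAdd 5 5 1, RSub 3 3 1]))
      (\<lambda>s. compress_frame n (Suc i) (D' ! i) (fst s) \<and> mem_lists (snd s) D' ts')"
  proof (rule triple_loopfree)
    fix reg mem assume "shrink_inv D ts i hi g N N (reg, mem)"
    then show "reg 0 = 0 \<and> (\<lambda>s. compress_frame n (Suc i) (D' ! i) (fst s) \<and> mem_lists (snd s) D' ts')
        (lrun (Block [RLoad 4 5, RAdd 5 5 1, RSub 3 3 1]) (reg, mem))"
      using n unfolding shrink_inv_def compress_frame_def mem_lists_def
      by (cases "g = 0") (auto simp: Let_def N_def D'_def ts'_def nth_shrink_targets)
  qed simp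
  have "reduced D0 ts0 (Suc i) D' ts'"
    unfolding D'_def ts'_def hi_def
    by (rule reduced_step[OF red i]) (simp add: g_def hi_def n_def)
  then have post: "compress_inv D0 ts0 (Suc i) s"
    if "compress_frame n (Suc i) (D' ! i) (fst s) \<and> mem_lists (snd s) D' ts'" for s
    using that unfolding compress_inv_def n_def prev_def by auto
  have "N \<le> n" by (simp add: N_def)
  then have "N * (csize shrink_body + 2) + 1 \<le> n * (csize shrink_body + 2) + 1"
    by (simp only: add_le_mono1 mult_le_mono1)
  then have time: "csize shrink_setup + ((N * (csize shrink_body + 2) + 1) +
      csize (Block [RLoad 4 5, RAdd 5 5 1, RSub 3 3 1])) \<le> compress_time (length D0)"
    unfolding compress_time_def n_def by simp
  show "triple (\<lambda>s. compress_frame (length D0) i (prev D i) (fst s) \<and> mem_lists (snd s) D ts)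
      compress_body (compress_time (length D0)) (compress_inv D0 ts0 (Suc i))"
    unfolding compress_body_def
    by (rule triple_conseq[OF triple_Seq[OF 1 triple_Seq[OF 2 3]] _ time post])
       (auto simp: n_def hi_def)
qed

text \<open>Targets beyond \<open>2 * e\<close> are out of reach of every node; they are moved just above \<open>2 * e\<close>.\<close>
definition cap_targets :: "nat \<Rightarrow> nat list \<Rightarrow> nat list" where
  "cap_targets e ts = map (\<lambda>j. if ts ! j \<le> 2 * e then ts ! j else 2 * e + Suc j) [0..<length ts]"

text \<open>Capping is a shrink with threshold \<open>e\<close>, above which there is no node.
  Taking \<open>g = sum_list ts\<close> makes the gap wide enough to contain every target beyond
  \<open>2*e\<close>.\<close>

lemma cap_targets:
  assumes "sorted D" "length ts = length D" "distinct ts" "\<forall>d\<in>set D. d \<le> e" "\<forall>t\<in>set ts. 0 < t"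
  shows "pos_match D (set (cap_targets e ts)) \<longleftrightarrow> pos_match D (set ts)"
    and "card (set (cap_targets e ts)) = length D"
    and "set (cap_targets e ts) \<subseteq> {1..2 * (e + length D)}"
proof -
  have "t \<le> 2 * e + (2 * sum_list ts + length ts)" if "t \<in> set ts" for t
    using member_le_sum_list[OF that] by linarith
  then have eq: "cap_targets e ts = shrink_targets e (sum_list ts) ts"
    unfolding cap_targets_def shrink_targets_def by (auto simp: shrink_target_def)
  have "map (shrink_dist e (sum_list ts)) D = D"
    using assms(4) by (intro map_idI) (simp add: shrink_dist_def)
  then show "pos_match D (set (cap_targets e ts)) \<longleftrightarrow> pos_match D (set ts)"
    using pos_match_shrink[of D ts e "sum_list ts"] assms(1-4) by (simp add: eq)
  show "card (set (cap_targets e ts)) = length D"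
    using distinct_shrink_targets[OF assms(3)] assms(2) by (simp add: eq distinct_card)
  show "set (cap_targets e ts) \<subseteq> {1..2 * (e + length D)}"
    using assms(2,5) by (auto simp: cap_targets_def Suc_le_eq)
qed

text \<open>From \<open>n\<close> in register 2 and \<open>e\<close> in register 4 this computes
  \<open>M\<close>, \<open>c\<close>, \<open>2*e\<close>, \<open>l\<close>, \<open>l + 2*c\<close>,
  \<open>N\<close> and \<open>B\<close> in registers 6, 7, 10, 12, 14, 17 and 18.\<close>

definition emit_setup :: com where
  "emit_setup = Block [RAdd 8 2 0, RAdd 9 1 0, RAdd 10 4 4, RAdd 5 2 2, RAdd 3 5 2, RAdd 3 3 4,
     RAdd 6 3 3, RAdd 6 6 3, RAdd 7 6 2, RAdd 12 10 5, RAdd 12 12 5, RAdd 12 12 2, RAdd 11 7 7,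
     RAdd 14 12 11, RAdd 18 7 4, RAdd 18 18 2, RAdd 17 18 12]"

text \<open>Cell \<open>l + x\<close> is set to 1 if \<open>x\<close> is a shifted target. The low nodes are written last because
  they overwrite \<open>D\<close> and \<open>ts\<close>; all other output goes to cells above \<open>l\<close>.\<close>
definition mark_body :: com where
  "mark_body =
    Seq (Block [RAdd 15 9 1, RLoad 13 15, RAdd 13 13 7, RAdd 16 12 9, RStore 13 16, RAdd 15 15 2,
      RLoad 13 15, RSub 16 13 10])
   (Seq (If 16 (Block [RAdd 13 10 9]) (Block []))
        (Block [RAdd 13 13 14, RStore 1 13, RAdd 9 9 1, RSub 8 8 1]))"

definition high_setup :: com where
  "high_setup = Block [RAdd 8 18 0, RAdd 9 12 2, RAdd 9 9 1, RAdd 13 18 1]"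

definition high_body :: com where
  "high_body =
    Seq (Block [RAdd 15 12 13, RLoad 16 15])
   (Seq (If 16 (Block []) (Block [RStore 13 9, RAdd 9 9 1]))
        (Block [RAdd 13 13 1, RSub 8 8 1]))"

definition low_setup :: com where
  "low_setup = Block [RAdd 8 12 0, RAdd 9 1 0]"

definition low_body :: com where
  "low_body = Block [RStore 6 9, RAdd 9 9 1, RSub 8 8 1]"

definition emit :: com where
  "emit = Seq emit_setup (Seq (While 8 mark_body) (Seq high_setup (Seq (While 8 high_body)
     (Seq low_setup (Seq (While 8 low_body) (Block [RStore 17 0]))))))"

definition emit_time :: "nat \<Rightarrow> nat \<Rightarrow> nat" where
  "emit_time e n = csize emit_setup + ((n * (csize mark_body + 2) + 1) + (csize high_setup +
     (((4*e + 11*n) * (csize high_body + 2) + 1) + (csize low_setup +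
     (((2*e + 5*n) * (csize low_body + 2) + 1) + csize (Block [RStore 17 0]))))))"

section \<open>Correctness of the output phase\<close>

context
  fixes D ts :: "nat list" and e n l M c B N :: nat and H :: "nat \<Rightarrow> nat list" and marks :: "nat \<Rightarrow> nat set"
  assumes n_def: "n = length D" and len_ts: "length ts = length D"
    and l_def: "l = 2*e + 5*n" and M_def: "M = 3*e + 9*n" and c_def: "c = 3*e + 10*n"
    and B_def: "B = 4*e + 11*n" and N_def: "N = 6*e + 16*n"
    and H_def: "\<And>k. H k = filter (\<lambda>x. x \<notin> (\<lambda>t. 2*c + t) ` set (cap_targets e ts)) [B + 1..<B + 1 + k]"
    and marks_def: "\<And>k. marks k = {l + 2*c + cap_targets e ts ! j |j. j < k}"
begin

lemmas prm = l_def M_def c_def B_def N_def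

definition emit_frame :: "(nat \<Rightarrow> nat) \<Rightarrow> bool" where
  "emit_frame reg \<longleftrightarrow> reg 0 = 0 \<and> reg 1 = 1 \<and> reg 2 = n \<and> reg 6 = M \<and> reg 7 = c \<and> reg 10 = 2*e \<and>
     reg 12 = l \<and> reg 14 = l + 2*c \<and> reg 17 = N \<and> reg 18 = B"

definition mark_inv :: "nat \<Rightarrow> state \<Rightarrow> bool" where
  "mark_inv k s \<longleftrightarrow> (case s of (reg, mem) \<Rightarrow>
     emit_frame reg \<and> reg 8 = n - k \<and> reg 9 = Suc k \<and>
     (\<forall>j<n. mem (Suc (Suc j)) = D ! j \<and> mem (n + Suc (Suc j)) = ts ! j) \<and>
     (\<forall>j<k. mem (l + Suc j) = D ! j + c) \<and>
     (\<forall>a>Suc (l + n). mem a = (if a \<in> marks k then 1 else 0)))"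

definition high_inv :: "nat \<Rightarrow> state \<Rightarrow> bool" where
  "high_inv k s \<longleftrightarrow> (case s of (reg, mem) \<Rightarrow>
     emit_frame reg \<and> reg 8 = B - k \<and> reg 9 = l + n + Suc (length (H k)) \<and> reg 13 = B + Suc k \<and>
     (\<forall>j<n. mem (l + Suc j) = D ! j + c) \<and>
     (\<forall>j<length (H k). mem (l + n + Suc j) = H k ! j) \<and>
     (\<forall>a\<in>{l + B + Suc k..l + 2*B}. mem a = (if a \<in> marks n then 1 else 0)))"

definition low_inv :: "nat \<Rightarrow> state \<Rightarrow> bool" where
  "low_inv k s \<longleftrightarrow> (case s of (reg, mem) \<Rightarrow>
     emit_frame reg \<and> reg 8 = l - k \<and> reg 9 = Suc k \<and>
     (\<forall>j<k. mem (Suc j) = M) \<and>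
     (\<forall>j<n. mem (l + Suc j) = D ! j + c) \<and>
     (\<forall>j<length (H B). mem (l + n + Suc j) = H B ! j))"

lemma nth_cap_targets:
  "j < n \<Longrightarrow> cap_targets e ts ! j = (if ts ! j \<le> 2 * e then ts ! j else 2 * e + Suc j)"
  by (simp add: cap_targets_def n_def len_ts)

lemma marks_Suc: "marks (Suc k) = insert (l + 2*c + cap_targets e ts ! k) (marks k)"
  unfolding marks_def by (auto simp: less_Suc_eq)

lemma emit_setup_correct:
  "triple (\<lambda>s. compress_frame n n e (fst s) \<and> mem_lists (snd s) D ts) emit_setup
    (csize emit_setup) (mark_inv 0)"
proof (rule triple_loopfree)
  fix reg mem
  assume "compress_frame n n e (fst (reg, mem)) \<and> mem_lists (snd (reg, mem)) D ts"
  then show "reg 0 = 0 \<and> mark_inv 0 (lrun emit_setup (reg, mem))"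
    unfolding mark_inv_def emit_frame_def compress_frame_def emit_setup_def mem_lists_def n_def[symmetric]
    by (auto simp: marks_def prm)
qed (simp add: emit_setup_def)

lemma mark_body_correct:
  assumes k: "k < n"
  shows "triple (mark_inv k) mark_body (csize mark_body) (mark_inv (Suc k))"
proof (rule triple_loopfree)
  fix reg mem assume inv: "mark_inv k (reg, mem)"
  define t where "t = cap_targets e ts ! k"
  have t: "t = (if ts ! k \<le> 2 * e then ts ! k else 2 * e + Suc k)"
    unfolding t_def using k by (rule nth_cap_targets)
  define a where "a = l + Suc k"
  define b where "b = l + 2*c + t"
  define mem' where "mem' = mem(a := D ! k + c, b := 1)"
  define reg' where "reg' = fst (lrun mark_body (reg, mem))"
  \<comment> \<open>The inputs end at cell \<open>2*n + 1\<close>, which is at most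
    \<open>l\<close>; shifted nodes occupy the next \<open>n\<close> cells after \<open>l\<close>,
    and marks lie beyond \<open>l + n + 1\<close>. So the two writes destroy nothing.\<close>
  have ab: "l < a" "a \<le> l + n" "Suc (l + n) < b" "2 * n < l"
    using k by (auto simp: a_def b_def prm)
  have "lrun mark_body (reg, mem) = (reg', mem') \<and> emit_frame reg' \<and>
      reg' 8 = n - Suc k \<and> reg' 9 = Suc (Suc k)"
    using inv k ab unfolding mark_inv_def emit_frame_def mark_body_def reg'_def mem'_def a_def b_def t
    by (auto simp: algebra_simps)
  then show "reg 0 = 0 \<and> mark_inv (Suc k) (lrun mark_body (reg, mem))"
    using inv ab unfolding mark_inv_def mem'_def marks_Suc t_def[symmetric] b_def[symmetric]
    by (auto simp: emit_frame_def less_Suc_eq a_def)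
qed (simp add: mark_body_def)

lemma high_setup_correct: "triple (mark_inv n) high_setup (csize high_setup) (high_inv 0)"
proof (rule triple_loopfree)
  fix reg mem assume "mark_inv n (reg, mem)"
  then show "reg 0 = 0 \<and> high_inv 0 (lrun high_setup (reg, mem))"
    unfolding mark_inv_def high_inv_def emit_frame_def high_setup_def
    by (auto simp: H_def prm)
qed (simp add: high_setup_def)

lemma mark_iff: "l + x \<in> marks n \<longleftrightarrow> x \<in> (\<lambda>t. 2*c + t) ` set (cap_targets e ts)"
proof -
  have "length (cap_targets e ts) = n" by (simp add: cap_targets_def len_ts n_def)
  then show ?thesis unfolding marks_def by (auto simp: in_set_conv_nth image_iff)
qed

lemma high_body_correct:
  assumes k: "k < B"
  shows "triple (high_inv k) high_body (csize high_body) (high_inv (Suc k))"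
proof (rule triple_loopfree)
  fix reg mem assume inv: "high_inv k (reg, mem)"
  define x where "x = B + Suc k"
  have HS: "H (Suc k) = (if l + x \<in> marks n then H k else H k @ [x])"
    unfolding H_def mark_iff x_def by simp
  have len: "length (H k) \<le> k" unfolding H_def
    by (rule order_trans[OF length_filter_le]) simp
  have "n \<le> B" by (simp add: prm)
  have read: "mem (l + x) = (if l + x \<in> marks n then 1 else 0)"
    using inv k by (simp add: high_inv_def x_def)
  define p where "p = l + n + Suc (length (H k))"
  define mem' where "mem' = (if l + x \<in> marks n then mem else mem(p := x))"
  define reg' where "reg' = fst (lrun high_body (reg, mem))"
  have reg: "emit_frame reg" "reg 8 = B - k" "reg 9 = p" "reg 13 = x"
    using inv by (auto simp: high_inv_def p_def x_def)
  have 1: "lrun high_body (reg, mem) = (reg', mem')"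
    using reg read unfolding reg'_def mem'_def high_body_def emit_frame_def by simp
  have 2: "emit_frame reg' \<and> reg' 8 = B - Suc k \<and> reg' 9 = l + n + Suc (length (H (Suc k))) \<and>
      reg' 13 = B + Suc (Suc k)"
    using reg read unfolding reg'_def high_body_def emit_frame_def HS p_def x_def by simp
  have low: "mem' (l + Suc j) = D ! j + c" if "j < n" for j
    using inv that by (simp add: high_inv_def mem'_def p_def)
  have high: "mem' (l + n + Suc j) = H (Suc k) ! j" if "j < length (H (Suc k))" for j
  proof -
    have old: "mem (l + n + Suc j) = H k ! j" if "j < length (H k)"
      using inv that unfolding high_inv_def by simp
    show ?thesis using that old unfolding HS mem'_def p_def
      by (auto simp: nth_append less_Suc_eq split: if_splits)
  qed
  have rest: "mem' a = (if a \<in> marks n then 1 else 0)" if "a \<in> {l + B + Suc (Suc k)..l + 2*B}" for a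
  proof -
    have "mem a = (if a \<in> marks n then 1 else 0)" using inv that by (simp add: high_inv_def)
    \<comment> \<open>The write position is at most \<open>l + n + 1 + k\<close> and unread marks
      start at \<open>l + B + k + 2\<close>, so the output never overtakes the reading.\<close>
    moreover have "a \<noteq> p" using that len \<open>n \<le> B\<close> by (auto simp: p_def)
    ultimately show ?thesis by (simp add: mem'_def)
  qed
  show "reg 0 = 0 \<and> high_inv (Suc k) (lrun high_body (reg, mem))"
    using reg(1) 2 low high rest unfolding 1 high_inv_def by (simp add: emit_frame_def)
qed (simp add: high_body_def)

lemma low_setup_correct: "triple (high_inv B) low_setup (csize low_setup) (low_inv 0)"
proof (rule triple_loopfree)
  fix reg mem assume "high_inv B (reg, mem)"
  then show "reg 0 = 0 \<and> low_inv 0 (lrun low_setup (reg, mem))"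
    unfolding high_inv_def low_inv_def emit_frame_def low_setup_def by auto
qed (simp add: low_setup_def)

lemma low_body_correct:
  assumes k: "k < l"
  shows "triple (low_inv k) low_body (csize low_body) (low_inv (Suc k))"
proof (rule triple_loopfree)
  fix reg mem assume "low_inv k (reg, mem)"
  then show "reg 0 = 0 \<and> low_inv (Suc k) (lrun low_body (reg, mem))"
    using k unfolding low_inv_def emit_frame_def low_body_def by (auto simp: less_Suc_eq)
qed (simp add: low_body_def)

text \<open>Register 0 contains 0, so the final store puts the length \<open>N\<close> into cell 0,
  where \<open>ram_output\<close> looks for it.\<close>

lemma finish_correct:
  assumes "length (pm_instance D e (set (cap_targets e ts))) = N"
  shows "triple (low_inv l) (Block [RStore 17 0]) (csize (Block [RStore 17 0]))
    (\<lambda>s. \<forall>pc. ram_output (pc, s) = pm_instance D e (set (cap_targets e ts)))"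
proof (rule triple_loopfree)
  fix reg mem assume inv: "low_inv l (reg, mem)"
  have ys: "pm_instance D e (set (cap_targets e ts)) = replicate l M @ map (\<lambda>d. d + c) D @ H B"
    unfolding pm_instance_def Let_def H_def prm n_def by (simp add: algebra_simps)
  have "mem (Suc j) = (replicate l M @ map (\<lambda>d. d + c) D @ H B) ! j" if "j < N" for j
  proof -
    have "N = l + n + length (H B)" using assms unfolding ys by (simp add: n_def)
    then have "j < l \<or> j - l < n \<and> j = l + (j - l) \<or>
        j - (l + n) < length (H B) \<and> j = l + n + (j - (l + n))"
      using that by linarith
    then consider "j < l" | i where "i < n" "j = l + i" | i where "i < length (H B)" "j = l + n + i"
      by blast
    then show ?thesis
    proof cases
      case 1
      then show ?thesis using inv by (simp add: low_inv_def nth_append)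
    next
      case 2
      then have "mem (l + Suc i) = D ! i + c" using inv by (simp add: low_inv_def)
      then show ?thesis using 2 by (simp add: nth_append n_def)
    next
      case 3
      then have "mem (l + n + Suc i) = H B ! i" using inv by (simp add: low_inv_def)
      then show ?thesis using 3 by (simp add: nth_append n_def)
    qed
  qed
  then show "reg 0 = 0 \<and> (\<forall>pc. ram_output (pc, lrun (Block [RStore 17 0]) (reg, mem)) =
      pm_instance D e (set (cap_targets e ts)))"
    using inv assms unfolding ys
    by (auto simp: low_inv_def emit_frame_def ram_output_def intro!: nth_equalityI)
qed simp

lemma emit_correct:
  assumes "length (pm_instance D e (set (cap_targets e ts))) = N"
  shows "triple (\<lambda>s. compress_frame n n e (fst s) \<and> mem_lists (snd s) D ts) emit (emit_time e n)
    (\<lambda>s. \<forall>pc. ram_output (pc, s) = pm_instance D e (set (cap_targets e ts)))"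
proof -
  have mark: "triple (mark_inv 0) (While 8 mark_body) (n * (csize mark_body + 2) + 1) (mark_inv n)"
    by (intro triple_While mark_body_correct) (auto simp: mark_inv_def emit_frame_def)
  have high: "triple (high_inv 0) (While 8 high_body) (B * (csize high_body + 2) + 1) (high_inv B)"
    by (intro triple_While high_body_correct) (auto simp: high_inv_def emit_frame_def)
  have low: "triple (low_inv 0) (While 8 low_body) (l * (csize low_body + 2) + 1) (low_inv l)"
    by (intro triple_While low_body_correct) (auto simp: low_inv_def emit_frame_def)
  show ?thesis unfolding emit_def emit_time_def B_def[symmetric] l_def[symmetric]
    by (intro triple_Seq[OF emit_setup_correct] triple_Seq[OF mark] triple_Seq[OF high_setup_correct]
        triple_Seq[OF high] triple_Seq[OF low_setup_correct] triple_Seq[OF low] finish_correct assms)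
qed

end

section \<open>Assembling the reduction and bounding its running time\<close>

definition start :: com where
  "start = Block [RConst 1 1, RLoad 2 1, RAdd 3 2 0, RConst 5 2]"

definition reduction :: com where
  "reduction = Seq start (Seq (While 3 compress_body) emit)"

definition reduction_time :: "nat \<Rightarrow> nat" where
  "reduction_time n = csize start + ((n * (compress_time n + 2) + 1) + emit_time (n * n) n)"

lemma start_correct:
  assumes "sorted D" "\<forall>d\<in>set D. 0 < d" "distinct ts" "\<forall>t\<in>set ts. 0 < t" "length ts = length D"
  shows "triple (\<lambda>s. s = snd (init (enc_pm D ts))) start (csize start) (compress_inv D ts 0)"
proof (rule triple_loopfree)
  fix reg mem assume init: "(reg, mem) = snd (init (enc_pm D ts))"
  have "reduced D ts 0 D ts" using assms by (simp add: reduced_def)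
  moreover have "mem_lists (snd (lrun start (reg, mem))) D ts"
    using init assms(5) by (auto simp: init_def enc_pm_def mem_lists_def start_def nth_append)
  \<comment> \<open>Register 4 still has its initial value 0, which is
    \<open>prev D 0\<close>.\<close>
  moreover have "compress_frame (length D) 0 (prev D 0) (fst (lrun start (reg, mem)))"
    using init by (auto simp: init_def enc_pm_def compress_frame_def start_def prev_def)
  ultimately show "reg 0 = 0 \<and> compress_inv D ts 0 (lrun start (reg, mem))"
    using init unfolding compress_inv_def by (auto simp: init_def)
qed (simp add: start_def)

definition correct_output :: "nat list \<Rightarrow> nat set \<Rightarrow> nat list \<Rightarrow> bool" where
  "correct_output D T ys \<longleftrightarrow>
     sorted ys \<and> (\<forall>y\<in>set ys. 0 < y) \<and> (two_visits ys \<longleftrightarrow> pos_match D T)"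

lemma emit_reduced:
  assumes red: "reduced D0 ts0 (length D0) D ts"
  shows "triple (\<lambda>s. compress_frame (length D0) (length D0) (prev D (length D0)) (fst s) \<and>
      mem_lists (snd s) D ts) emit (emit_time (length D0 * length D0) (length D0))
    (\<lambda>s. \<exists>ys. (\<forall>pc. ram_output (pc, s) = ys) \<and> correct_output D0 (set ts0) ys)"
proof -
  define n e where "n = length D0" and "e = prev D n"
  define T where "T = set (cap_targets e ts)"
  have D: "length D = n" "length ts = n" "sorted D" "\<forall>d\<in>set D. 0 < d" "distinct ts"
      "\<forall>t\<in>set ts. 0 < t"
    and pm: "pos_match D (set ts) \<longleftrightarrow> pos_match D0 (set ts0)"
    and e_le: "e \<le> n * n"
    using red unfolding reduced_def n_def e_def prev_def by auto
  have le_e: "\<forall>d\<in>set D. d \<le> e"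
  proof
    fix d assume "d \<in> set D"
    then obtain j where "j < n" "d = D ! j" using D(1) by (auto simp: in_set_conv_nth)
    moreover then have "D ! j \<le> D ! (n - 1)" using D(1,3) by (intro sorted_nth_mono) auto
    ultimately show "d \<le> e" by (simp add: e_def prev_def)
  qed
  have T: "pos_match D T \<longleftrightarrow> pos_match D (set ts)" "card T = length D" "T \<subseteq> {1..2 * (e + length D)}"
    unfolding T_def using cap_targets[OF D(3) _ D(5) le_e D(6)] D(1,2) by auto
  have De: "\<forall>d\<in>set D. 0 < d \<and> d \<le> e" using D(4) le_e by blast
  note inst = D(3) De T(3,2)
  have len: "length (pm_instance D e T) = 6*e + 16*n"
    using pm_instance(2)[OF inst] D(1) by simp
  have out: "correct_output D0 (set ts0) (pm_instance D e T)"
    unfolding correct_output_def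
    using pm_instance(1,3,4)[OF inst] T(1) pm by blast
  have emit: "triple (\<lambda>s. compress_frame n n e (fst s) \<and> mem_lists (snd s) D ts) emit (emit_time e n)
    (\<lambda>s. \<forall>pc. ram_output (pc, s) = pm_instance D e T)"
    unfolding T_def using D(1,2) len[unfolded T_def]
    by (intro emit_correct) (rule refl | simp)+
  have le: "emit_time e n \<le> emit_time (n * n) n"
    unfolding emit_time_def using e_le
    by (intro add_mono mult_le_mono order_refl) auto
  show ?thesis unfolding n_def[symmetric] e_def[symmetric]
  proof (rule triple_conseq[OF emit _ le])
    fix s assume "\<forall>pc. ram_output (pc, s) = pm_instance D e T"
    with out show "\<exists>ys. (\<forall>pc. ram_output (pc, s) = ys) \<and> correct_output D0 (set ts0) ys" by blast
  qed
qed

lemma reduction_correct: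
  assumes "sorted D" "\<forall>d\<in>set D. 0 < d" "distinct ts" "\<forall>t\<in>set ts. 0 < t" "length ts = length D"
  shows "triple (\<lambda>s. s = snd (init (enc_pm D ts))) reduction (reduction_time (length D))
    (\<lambda>s. \<exists>ys. (\<forall>pc. ram_output (pc, s) = ys) \<and> correct_output D (set ts) ys)"
proof -
  have compress: "triple (compress_inv D ts 0) (While 3 compress_body)
      (length D * (compress_time (length D) + 2) + 1) (compress_inv D ts (length D))"
    by (intro triple_While compress_body_correct)
       (auto simp: compress_inv_def compress_frame_def)
  have emit: "triple (compress_inv D ts (length D)) emit (emit_time (length D * length D) (length D))
      (\<lambda>s. \<exists>ys. (\<forall>pc. ram_output (pc, s) = ys) \<and> correct_output D (set ts) ys)"
    unfolding compress_inv_def[abs_def] by (intro triple_ex triple_pure emit_reduced)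
  show ?thesis unfolding reduction_def reduction_time_def
    by (intro triple_Seq[OF start_correct] triple_Seq[OF compress] emit assms)
qed

text \<open>Arithmetic has unit cost, so the bound depends on \<open>n\<close> alone:
  \<open>n\<close> sweeps over \<open>n\<close> entries and output loops of quadratic
  length.\<close>

lemma reduction_time_le: "reduction_time n \<le> 200 * (n + 1) ^ 2"
  unfolding reduction_time_def compress_time_def emit_time_def start_def shrink_setup_def
    shrink_body_def emit_setup_def mark_body_def high_setup_def high_body_def low_setup_def low_body_def
  by (simp add: power2_eq_square algebra_simps)

lemma length_le_enc_size: "length xs \<le> enc_size xs"
  unfolding enc_size_def by (induction xs) auto

theorem theorem8:
  "\<exists>(prog :: instr list) (c :: nat) (k :: nat).
     \<forall>D ts. sorted D \<and> (\<forall>x\<in>set D. 0 < x) \<and> distinct ts \<and> (\<forall>t\<in>set ts. 0 < t)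
            \<and> length ts = length D \<longrightarrow>
       (\<exists>t ys. t \<le> c * (enc_size (enc_pm D ts) + 1) ^ k
          \<and> halted prog (exec prog t (init (enc_pm D ts)))
          \<and> ram_output (exec prog t (init (enc_pm D ts))) = ys
          \<and> sorted ys \<and> (\<forall>y\<in>set ys. 0 < y)
          \<and> (two_visits ys \<longleftrightarrow> pos_match D (set ts)))"
proof -
  define prog where "prog = comp 0 reduction"
  have "\<exists>t ys. t \<le> 200 * (enc_size (enc_pm D ts) + 1) ^ 2
          \<and> halted prog (exec prog t (init (enc_pm D ts)))
          \<and> ram_output (exec prog t (init (enc_pm D ts))) = ys
          \<and> sorted ys \<and> (\<forall>y\<in>set ys. 0 < y)
          \<and> (two_visits ys \<longleftrightarrow> pos_match D (set ts))"
    if *: "sorted D \<and> (\<forall>x\<in>set D. 0 < x) \<and> distinct ts \<and> (\<forall>t\<in>set ts. 0 < t) \<and> length ts = length D"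
    for D ts
  proof -
    define s where "s = snd (init (enc_pm D ts))"
    have tr: "triple (\<lambda>s. s = snd (init (enc_pm D ts))) reduction (reduction_time (length D))
        (\<lambda>s. \<exists>ys. (\<forall>pc. ram_output (pc, s) = ys) \<and> correct_output D (set ts) ys)"
      using * reduction_correct by blast
    have "placed prog 0 (comp 0 reduction)" by (simp add: placed_def prog_def)
    then obtain t s' where t: "t \<le> reduction_time (length D)"
      and ex: "exec prog t (0, s) = (0 + csize reduction, s')"
      and "\<exists>ys. (\<forall>pc. ram_output (pc, s') = ys) \<and> correct_output D (set ts) ys"
      by (rule tripleE[OF tr _ s_def])
    then obtain ys where ys: "\<And>pc. ram_output (pc, s') = ys" "correct_output D (set ts) ys" by blast
    have init: "init (enc_pm D ts) = (0, s)" by (simp add: s_def init_def)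
    have "length D \<le> enc_size (enc_pm D ts)"
      using length_le_enc_size[of "enc_pm D ts"] by (simp add: enc_pm_def)
    then have "(length D + 1) ^ 2 \<le> (enc_size (enc_pm D ts) + 1) ^ 2"
      by (intro power_mono) linarith+
    then have "t \<le> 200 * (enc_size (enc_pm D ts) + 1) ^ 2"
      using t reduction_time_le[of "length D"] by linarith
    \<comment> \<open>Control ends one past the last instruction, which counts as halted.\<close>
    moreover have "halted prog (exec prog t (init (enc_pm D ts)))"
      unfolding init ex halted_def by (simp add: prog_def)
    moreover have "ram_output (exec prog t (init (enc_pm D ts))) = ys"
      unfolding init ex by (rule ys(1))
    ultimately show ?thesis using ys(2) unfolding correct_output_def by blast
  qed
  then show ?thesis by blast
qed

end
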